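(* Let $a,b\in\mathbb{R}$ be constants with $0<a<1$, $b\neq0$ and $a^2+4b^2+4b\neq 0$. Let $\alpha(s)=(x(s),0,z(s))$ be the generating curve of a parabolic surface $S$ in hyperbolic space $\mathbb{H}^3$ that satisfies $aH+bK=1$, with initial conditions $x(0)=0$, $z(0)=z_0>0$, $\theta(0)=0$, defined on its maximal domain $(-\bar s,\bar s)$, and let $\theta_1=\lim_{s\to\bar s}\theta(s)$. \begin{enumerate} \item If $a+2b<0$, then $\alpha$ has one maximum and $\alpha$ is a concave (non-entire) vertical graph. If $b<-(1+\sqrt{1-a^2})/2$, the surface $S$ is complete and intersects $\mathbb{S}^2_\infty$ making an angle $\theta_1$ such that $a\cos\theta_1-b\sin^2\theta_1-1=0$; the asymptotic boundary of $S$ is formed by two parallel straight lines. If $-(1+\sqrt{1-a^2})/2<b<-a/2$, then $S$ is not complete. \item Assume $a+2b>0$. If $a-2b>0$, then $S$ is complete and invariant by a group of translations in the $x$-direction; moreover, $\alpha$ has self-intersections and it presents one maximum and one minimum in each period. If $a-2b\leq 0$, then $S$ is not complete; moreover, $\alpha$ is not a vertical graph, and it has a minimum. \end{enumerate}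
   Context: Hyperbolic space $\mathbb{H}^3$ is the upper half-space $\{(x,y,z)\in\mathbb{R}^3: z>0\}$ with metric $(dx^2+dy^2+dz^2)/z^2$; its ideal boundary is $\mathbb{S}^2_\infty=\{z=0\}\cup\{\infty\}$, and $L=\mathbb{S}^2_\infty\cap\{y=0\}$. "Vertical", "horizontal", "translation", "straight line" are meant in the Euclidean (affine) sense. A parabolic surface is a surface invariant under a group of parabolic isometries, taken to be the Euclidean translations in the direction $(0,1,0)$; it is parametrized as $X(s,t)=(x(s),t,z(s))$, $t\in\mathbb{R}$, where the generating curve $\alpha(s)=(x(s),0,z(s))$ is parametrized by Euclidean arc length with $\alpha'(s)=(\cos\theta(s),0,\sin\theta(s))$. With respect to the normal direction $(-\sin\theta,0,\cos\theta)$, the principal curvatures are $\kappa_1=z\theta'+\cos\theta$, $\kappa_2=\cos\theta$; $H=(\kappa_1+\kappa_2)/2$ and $K=\kappa_1\kappa_2-1$ is the intrinsic Gauss curvature. Thus $aH+bK=1$ reads $$\left(\tfrac a2+b\cos\theta\right)z\theta'+a\cos\theta-b\sin^2\theta=1,$$ and $\alpha$ is the maximal solution of this equation together with $x'=\cos\theta$, $z'=\sin\theta$ and the given initial conditions (the solution is symmetric about the line $x=0$; $\theta$ is monotone, so the limit $\theta_1$ makes sense). A vertical graph means a graph $z=z(x)$ over a subset of $L$; non-entire means that this subset is not all of the $x$-axis. Maxima and minima of $\alpha$ are those of the height function $z(s)$. Complete means complete for the metric induced from $\mathbb{H}^3$; the asymptotic boundary of $S$ is the set of its limit points in the ideal boundary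 plane $\{z=0\}$. *)

theory Defs
  imports "HOL-Analysis.Analysis"
begin

text \<open>
  Points of the upper half-space model of hyperbolic 3-space are triples \<open>(x, y, z)\<close> with
  \<open>z > 0\<close>; the type \<open>real \<times> real \<times> real\<close> carries the Euclidean norm.  Parameter intervals are
  sets \<open>D\<close> of reals; outside \<open>D\<close> the functions \<open>x\<close>, \<open>z\<close>, \<open>\<theta>\<close> are irrelevant.
\<close>

definition generating_curve :: "(real \<Rightarrow> real) \<Rightarrow> (real \<Rightarrow> real) \<Rightarrow> real \<Rightarrow> real \<times> real \<times> real" where
  "generating_curve x z s = (x s, 0, z s)"

definition parabolic_immersion ::
    "(real \<Rightarrow> real) \<Rightarrow> (real \<Rightarrow> real) \<Rightarrow> real \<times> real \<Rightarrow> real \<times> real \<times> real" where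
  "parabolic_immersion x z = (\<lambda>(s, t). (x s, t, z s))"

definition parabolic_surface ::
    "real set \<Rightarrow> (real \<Rightarrow> real) \<Rightarrow> (real \<Rightarrow> real) \<Rightarrow> (real \<times> real \<times> real) set" where
  "parabolic_surface D x z = parabolic_immersion x z ` (D \<times> UNIV)"


subsection \<open>Curvatures and the linear Weingarten equation\<close>

text \<open>
  Principal curvatures of the parabolic surface with respect to the normal direction
  \<open>(- sin \<theta>, 0, cos \<theta>)\<close>: the Euclidean principal curvatures \<open>\<theta>'\<close> and \<open>0\<close>, multiplied by \<open>z\<close>,
  plus the third coordinate of the Euclidean unit normal.
\<close>

definition principal_curvature1 :: "(real \<Rightarrow> real) \<Rightarrow> (real \<Rightarrow> real) \<Rightarrow> real \<Rightarrow> real" where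
  "principal_curvature1 z \<theta> s = z s * deriv \<theta> s + cos (\<theta> s)"

definition principal_curvature2 :: "(real \<Rightarrow> real) \<Rightarrow> real \<Rightarrow> real" where
  "principal_curvature2 \<theta> s = cos (\<theta> s)"

definition mean_curvature :: "(real \<Rightarrow> real) \<Rightarrow> (real \<Rightarrow> real) \<Rightarrow> real \<Rightarrow> real" where
  "mean_curvature z \<theta> s = (principal_curvature1 z \<theta> s + principal_curvature2 \<theta> s) / 2"

text \<open>The intrinsic Gauss curvature; \<open>-1\<close> is the sectional curvature of the ambient space.\<close>

definition gauss_curvature :: "(real \<Rightarrow> real) \<Rightarrow> (real \<Rightarrow> real) \<Rightarrow> real \<Rightarrow> real" where
  "gauss_curvature z \<theta> s = principal_curvature1 z \<theta> s * principal_curvature2 \<theta> s - 1"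

definition weingarten_profile ::
    "real \<Rightarrow> real \<Rightarrow> real \<Rightarrow> real set \<Rightarrow>
      (real \<Rightarrow> real) \<Rightarrow> (real \<Rightarrow> real) \<Rightarrow> (real \<Rightarrow> real) \<Rightarrow> bool" where
  "weingarten_profile a b z0 D x z \<theta> \<longleftrightarrow>
     open D \<and> is_interval D \<and> 0 \<in> D \<and> x 0 = 0 \<and> z 0 = z0 \<and> \<theta> 0 = 0 \<and>
     (\<forall>s\<in>D. z s > 0 \<and>
        (x has_real_derivative cos (\<theta> s)) (at s) \<and>
        (z has_real_derivative sin (\<theta> s)) (at s) \<and>
        \<theta> differentiable (at s) \<and>
        a * mean_curvature z \<theta> s + b * gauss_curvature z \<theta> s = 1)"

definition maximal_weingarten_profile ::
    "real \<Rightarrow> real \<Rightarrow> real \<Rightarrow> real set \<Rightarrow>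
      (real \<Rightarrow> real) \<Rightarrow> (real \<Rightarrow> real) \<Rightarrow> (real \<Rightarrow> real) \<Rightarrow> bool" where
  "maximal_weingarten_profile a b z0 D x z \<theta> \<longleftrightarrow>
     weingarten_profile a b z0 D x z \<theta> \<and>
     (\<forall>D' x' z' \<theta>'. weingarten_profile a b z0 D' x' z' \<theta>' \<and> D \<subseteq> D' \<and>
        (\<forall>s\<in>D. x' s = x s \<and> z' s = z s \<and> \<theta>' s = \<theta> s) \<longrightarrow> D' = D)"

text \<open>
  The end of a parameter interval may be infinite; a limit at an end \<open>e\<close> is taken along the
  filter \<open>F\<close>, which is \<open>at_left e\<close> or \<open>at_right e\<close> in the extended reals.
\<close>

definition tends_at_end :: "(real \<Rightarrow> 'a::topological_space) \<Rightarrow> 'a \<Rightarrow> ereal filter \<Rightarrow> bool" where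
  "tends_at_end f l F \<longleftrightarrow> ((\<lambda>s. f (real_of_ereal s)) \<longlongrightarrow> l) F"


subsection \<open>Completeness of the induced metric\<close>

definition hyperbolic_speed :: "(real \<Rightarrow> real \<times> real \<times> real) \<Rightarrow> real \<Rightarrow> real" where
  "hyperbolic_speed g u = norm (vector_derivative g (at u)) / snd (snd (g u))"

text \<open>
  The Riemannian distance on the parameter domain \<open>D \<times> UNIV\<close> of the (possibly self-intersecting)
  surface, for the metric pulled back by the immersion: infimum of the hyperbolic lengths of the
  images of piecewise continuously differentiable paths.  The predicate \<open>valid_path\<close> allows the
  derivative to be unbounded near the finitely many exceptional points, so a path may have infinite
  length, and \<open>integral\<close> would assign it the value 0; \<open>has_integral\<close> discards such paths.
  The value off the domain only serves to make the distance total.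
\<close>

definition induced_distance ::
    "real set \<Rightarrow> (real \<Rightarrow> real) \<Rightarrow> (real \<Rightarrow> real) \<Rightarrow> real \<times> real \<Rightarrow> real \<times> real \<Rightarrow> real" where
  "induced_distance D x z p q =
     (if p \<in> D \<times> UNIV \<and> q \<in> D \<times> UNIV
      then Inf {l. \<exists>\<gamma>. valid_path \<gamma> \<and> path_image \<gamma> \<subseteq> D \<times> UNIV \<and>
                      pathstart \<gamma> = p \<and> pathfinish \<gamma> = q \<and>
                      (hyperbolic_speed (parabolic_immersion x z \<circ> \<gamma>) has_integral l) {0..1}}
      else 0)"

definition complete_surface :: "real set \<Rightarrow> (real \<Rightarrow> real) \<Rightarrow> (real \<Rightarrow> real) \<Rightarrow> bool" where
  "complete_surface D x z \<longleftrightarrow> Metric_space.mcomplete (D \<times> UNIV) (induced_distance D x z)"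


subsection \<open>Geometry of the generating curve and of the surface\<close>

text \<open>The graph of \<open>f\<close> over the subset \<open>A\<close> of the \<open>x\<close>-axis, in the plane \<open>y = 0\<close>.\<close>

definition vertical_graph :: "real set \<Rightarrow> (real \<Rightarrow> real) \<Rightarrow> (real \<times> real \<times> real) set" where
  "vertical_graph A f = (\<lambda>u. (u, 0, f u)) ` A"

definition is_vertical_graph :: "(real \<times> real \<times> real) set \<Rightarrow> bool" where
  "is_vertical_graph C \<longleftrightarrow> (\<exists>A f. C = vertical_graph A f)"

definition is_concave_nonentire_vertical_graph :: "(real \<times> real \<times> real) set \<Rightarrow> bool" where
  "is_concave_nonentire_vertical_graph C \<longleftrightarrow>
     (\<exists>A f. C = vertical_graph A f \<and> concave_on A f \<and> A \<noteq> UNIV)"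

definition maximum_at :: "real set \<Rightarrow> (real \<Rightarrow> real) \<Rightarrow> real \<Rightarrow> bool" where
  "maximum_at D z s \<longleftrightarrow> s \<in> D \<and> (\<forall>u\<in>D. z u \<le> z s)"

definition local_maximum_at :: "real set \<Rightarrow> (real \<Rightarrow> real) \<Rightarrow> real \<Rightarrow> bool" where
  "local_maximum_at D z s \<longleftrightarrow> s \<in> D \<and> eventually (\<lambda>u. z u \<le> z s) (at s within D)"

definition minimum_at :: "real set \<Rightarrow> (real \<Rightarrow> real) \<Rightarrow> real \<Rightarrow> bool" where
  "minimum_at D z s \<longleftrightarrow> s \<in> D \<and> (\<forall>u\<in>D. z s \<le> z u)"

definition local_minimum_at :: "real set \<Rightarrow> (real \<Rightarrow> real) \<Rightarrow> real \<Rightarrow> bool" where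
  "local_minimum_at D z s \<longleftrightarrow> s \<in> D \<and> eventually (\<lambda>u. z s \<le> z u) (at s within D)"

text \<open>
  ``One maximum'' in a part \<open>I\<close> of the domain \<open>D\<close>: the global maximum is attained in \<open>I\<close>, and \<open>I\<close>
  contains no other maximum, not even a local one.
\<close>

definition one_maximum_in :: "real set \<Rightarrow> (real \<Rightarrow> real) \<Rightarrow> real set \<Rightarrow> bool" where
  "one_maximum_in D z I \<longleftrightarrow>
     (\<exists>s\<in>I. maximum_at D z s \<and> (\<forall>u\<in>I. local_maximum_at D z u \<longrightarrow> u = s))"

definition one_minimum_in :: "real set \<Rightarrow> (real \<Rightarrow> real) \<Rightarrow> real set \<Rightarrow> bool" where
  "one_minimum_in D z I \<longleftrightarrow>
     (\<exists>s\<in>I. minimum_at D z s \<and> (\<forall>u\<in>I. local_minimum_at D z u \<longrightarrow> u = s))"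

definition has_self_intersections ::
    "real set \<Rightarrow> (real \<Rightarrow> real \<times> real \<times> real) \<Rightarrow> bool" where
  "has_self_intersections D \<alpha> \<longleftrightarrow> \<not> inj_on \<alpha> D"

definition straight_line :: "real \<times> real \<times> real \<Rightarrow> real \<times> real \<times> real \<Rightarrow> (real \<times> real \<times> real) set" where
  "straight_line p v = range (\<lambda>t. p + t *\<^sub>R v)"

definition two_parallel_straight_lines :: "(real \<times> real \<times> real) set \<Rightarrow> bool" where
  "two_parallel_straight_lines A \<longleftrightarrow>
     (\<exists>p q v. v \<noteq> 0 \<and> straight_line p v \<noteq> straight_line q v \<and>
        A = straight_line p v \<union> straight_line q v)"

definition ideal_plane :: "(real \<times> real \<times> real) set" where
  "ideal_plane = {p. snd (snd p) = 0}"

definition asymptotic_boundary :: "(real \<times> real \<times> real) set \<Rightarrow> (real \<times> real \<times> real) set" where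
  "asymptotic_boundary S = {p \<in> ideal_plane. p islimpt S}"

text \<open>
  The curve \<open>\<alpha>\<close>, contained in the plane \<open>y = 0\<close>, reaches the ideal plane at one of its ends, and its
  tangent direction converges there to \<open>(cos \<phi>, 0, sin \<phi>)\<close>, so that \<open>\<phi>\<close> is the oriented angle from the
  \<open>x\<close>-axis to \<open>\<alpha>\<close>.  The plane \<open>y = 0\<close> is orthogonal to the rulings of a parabolic surface, so this
  is also its (dihedral) angle with the ideal plane.
\<close>

definition meets_ideal_plane_at_angle ::
    "(real \<Rightarrow> real \<times> real \<times> real) \<Rightarrow> ereal filter \<Rightarrow> real \<Rightarrow> bool" where
  "meets_ideal_plane_at_angle \<alpha> F \<phi> \<longleftrightarrow>
     (\<exists>p\<in>ideal_plane. tends_at_end \<alpha> p F) \<and>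
     tends_at_end (\<lambda>s. vector_derivative \<alpha> (at s)) (cos \<phi>, 0, sin \<phi>) F"

definition x_translation_group :: "real \<Rightarrow> (real \<times> real \<times> real \<Rightarrow> real \<times> real \<times> real) set" where
  "x_translation_group p = range (\<lambda>n::int. \<lambda>q. q + (of_int n * p, 0, 0))"

definition invariant_under ::
    "(real \<times> real \<times> real \<Rightarrow> real \<times> real \<times> real) set \<Rightarrow> (real \<times> real \<times> real) set \<Rightarrow> bool" where
  "invariant_under G S \<longleftrightarrow> (\<forall>g\<in>G. g ` S = S)"

text \<open>\<open>T\<close> is a period of \<open>\<alpha>\<close> up to the translation by \<open>p\<close> in the \<open>x\<close>-direction.\<close>

definition periodic_up_to_translation ::
    "real set \<Rightarrow> (real \<Rightarrow> real \<times> real \<times> real) \<Rightarrow> real \<Rightarrow> real \<Rightarrow> bool" where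
  "periodic_up_to_translation D \<alpha> T p \<longleftrightarrow>
     (\<forall>s\<in>D. s + T \<in> D \<and> \<alpha> (s + T) = \<alpha> s + (p, 0, 0))"

end

theory Submission
  imports Defs
begin

text \<open>
Write \<open>A = a/2 + b cos \<theta>\<close> and \<open>N = 1 - a cos \<theta> + b sin\<^sup>2 \<theta>\<close>, so that the Weingarten equation reads
\<open>A z \<theta>' = N\<close>. Since \<open>dN/d\<theta> = 2 A sin \<theta>\<close> and \<open>z' = sin \<theta>\<close>, the quotient \<open>N / z\<^sup>2\<close> is constant along
the curve (lemma \<open>first_integral\<close>), with the positive value \<open>k = (1 - a) / z0\<^sup>2\<close>. Three consequences carry
the whole classification.

First, \<open>N\<close> is positive along the curve, hence \<open>A\<close> has no zero there. So \<open>\<theta>\<close> is monotone, with the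
direction given by the sign of \<open>a + 2 b = 2 A(0)\<close>. Second, the height is the function
\<open>sqrt (N(\<theta>) / k)\<close> of the angle. Third, \<open>\<theta>' = k z / A\<close> becomes an autonomous scalar equation, which is
solved by the inverse of a primitive \<open>\<tau>\<close> of \<open>A / (k height)\<close>; maximality of the profile then says that
\<open>\<theta>\<close> sweeps the whole interval around 0 on which \<open>A \<noteq> 0\<close> and \<open>N > 0\<close> (lemma \<open>time_map\<close>).

If \<open>a + 2 b < 0\<close>, then \<open>cos \<theta> > 0\<close> and the slope \<open>tan \<theta>\<close> decreases, so the curve is a concave graph.
The identity \<open>(2 A)\<^sup>2 = \<Delta> - 4 b N\<close> with \<open>\<Delta> = a\<^sup>2 + 4 b\<^sup>2 + 4 b\<close> decides which of \<open>N\<close> and \<open>A\<close> vanishes at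
the end: for \<open>\<Delta> > 0\<close> it is \<open>N\<close>, the curve reaches height 0, and \<open>ln z\<close> is a proper function with
gradient at most 1, which gives completeness; for \<open>\<Delta> < 0\<close> the function \<open>N\<close> is bounded below, and a
bounded parameter interval ends at positive height, which contradicts completeness.

If \<open>a + 2 b > 0\<close> and \<open>a - 2 b > 0\<close>, then \<open>A\<close> and \<open>N\<close> have positive bounds for all angles, and \<open>\<theta>\<close> is a
diffeomorphism of the line onto itself. Evenness and \<open>2 pi\<close>-periodicity of \<open>A\<close> and \<open>N\<close> yield the
reflection and translation symmetries. The displacement in a period has the sign of \<open>\<Delta>\<close>, and this is
where \<open>\<Delta> \<noteq> 0\<close> is needed (lemma \<open>p_nonzero\<close>). If \<open>a - 2 b \<le> 0\<close>, the angle exceeds \<open>pi/2\<close> but stays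
below the zero of \<open>A\<close>, which is approached in bounded parameter time at positive height.
\<close>

section \<open>The induced metric of a parabolic surface\<close>

text \<open>
The induced metric on the parameter strip \<open>D \<times> UNIV\<close> is the Euclidean metric divided by \<open>z\<^sup>2\<close>, because
\<open>x'\<^sup>2 + z'\<^sup>2 = 1\<close>. The upper bound \<open>M\<close> of the height makes the induced distance dominate a multiple of
the Euclidean distance; it is what separates points.
\<close>

locale profile_strip =
  fixes D :: "real set" and x z \<theta> :: "real \<Rightarrow> real" and M :: real
  assumes interval_D: "is_interval D"
    and x_deriv: "s \<in> D \<Longrightarrow> (x has_real_derivative cos (\<theta> s)) (at s)"
    and z_deriv: "s \<in> D \<Longrightarrow> (z has_real_derivative sin (\<theta> s)) (at s)"
    and z_pos: "s \<in> D \<Longrightarrow> 0 < z s"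
    and z_le: "s \<in> D \<Longrightarrow> z s \<le> M"
begin

abbreviation speed :: "(real \<Rightarrow> real \<times> real) \<Rightarrow> real \<Rightarrow> real" where
  "speed \<gamma> \<equiv> hyperbolic_speed (parabolic_immersion x z \<circ> \<gamma>)"

definition path_of_length :: "(real \<Rightarrow> real \<times> real) \<Rightarrow> real \<Rightarrow> real \<times> real \<Rightarrow> real \<times> real \<Rightarrow> bool" where
  "path_of_length \<gamma> l p q \<longleftrightarrow> valid_path \<gamma> \<and> path_image \<gamma> \<subseteq> D \<times> UNIV \<and>
     pathstart \<gamma> = p \<and> pathfinish \<gamma> = q \<and> (speed \<gamma> has_integral l) {0..1}"

abbreviation surface_dist :: "real \<times> real \<Rightarrow> real \<times> real \<Rightarrow> real" where
  "surface_dist \<equiv> induced_distance D x z"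

lemma speed_eq:
  assumes "(\<gamma> has_vector_derivative v) (at u)" and "fst (\<gamma> u) \<in> D"
  shows "speed \<gamma> u = norm v / z (fst (\<gamma> u))"
proof -
  obtain s t where g: "\<gamma> u = (s, t)" by (cases "\<gamma> u")
  obtain v1 v2 where v: "v = (v1, v2)" by (cases v)
  have D: "s \<in> D" using assms(2) g by simp
  have 1: "((\<lambda>u. fst (\<gamma> u)) has_vector_derivative v1) (at u)"
    and 2: "((\<lambda>u. snd (\<gamma> u)) has_vector_derivative v2) (at u)"
    using assms(1) unfolding v has_vector_derivative_def
    by (auto dest: has_derivative_fst has_derivative_snd)
  have x1: "((\<lambda>u. x (fst (\<gamma> u))) has_vector_derivative v1 * cos (\<theta> s)) (at u)"
    using field_vector_diff_chain_at[OF 1, of x "cos (\<theta> s)"] x_deriv[OF D] g by (simp add: o_def)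
  have z1: "((\<lambda>u. z (fst (\<gamma> u))) has_vector_derivative v1 * sin (\<theta> s)) (at u)"
    using field_vector_diff_chain_at[OF 1, of z "sin (\<theta> s)"] z_deriv[OF D] g by (simp add: o_def)
  have "((parabolic_immersion x z \<circ> \<gamma>) has_vector_derivative
          (v1 * cos (\<theta> s), v2, v1 * sin (\<theta> s))) (at u)"
    using has_vector_derivative_Pair[OF x1 has_vector_derivative_Pair[OF 2 z1]]
    by (simp add: parabolic_immersion_def o_def case_prod_beta)
  then have "vector_derivative (parabolic_immersion x z \<circ> \<gamma>) (at u) =
      (v1 * cos (\<theta> s), v2, v1 * sin (\<theta> s))"
    by (rule vector_derivative_at)
  moreover have "norm (v1 * cos (\<theta> s), v2, v1 * sin (\<theta> s)) = norm v"
  proof -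
    have "(v1 * cos (\<theta> s))\<^sup>2 + (v2\<^sup>2 + (v1 * sin (\<theta> s))\<^sup>2) = v1\<^sup>2 * ((cos (\<theta> s))\<^sup>2 + (sin (\<theta> s))\<^sup>2) + v2\<^sup>2"
      by (simp only: power_mult_distrib algebra_simps)
    then show ?thesis by (simp add: v norm_Pair)
  qed
  ultimately show ?thesis
    by (simp add: hyperbolic_speed_def parabolic_immersion_def g)
qed

lemma valid_path_smooth_points:
  fixes \<gamma> :: "real \<Rightarrow> real \<times> real"
  assumes "valid_path \<gamma>"
  obtains F where "finite F"
    and "\<And>u. u \<in> {0..1} - F \<Longrightarrow> (\<gamma> has_vector_derivative vector_derivative \<gamma> (at u)) (at u)"
  using assms
  by (auto simp: valid_path_def piecewise_C1_differentiable_on_def C1_differentiable_on_eq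
      vector_derivative_works)

lemma path_in_D: "path_image \<gamma> \<subseteq> D \<times> UNIV \<Longrightarrow> u \<in> {0..1} \<Longrightarrow> fst (\<gamma> u) \<in> D"
  by (force simp: path_image_def)

lemma speed_nonneg: "fst (\<gamma> u) \<in> D \<Longrightarrow> 0 \<le> speed \<gamma> u"
  using z_pos[of "fst (\<gamma> u)"] by (simp add: hyperbolic_speed_def parabolic_immersion_def case_prod_beta)

lemma path_of_length_nonneg: "path_of_length \<gamma> l p q \<Longrightarrow> 0 \<le> l"
  unfolding path_of_length_def
  by (metis has_integral_nonneg speed_nonneg path_in_D)

lemma path_of_length_reverse:
  assumes "path_of_length \<gamma> l p q"
  shows "path_of_length (reversepath \<gamma>) l q p"
proof -
  have v: "valid_path \<gamma>" and im: "path_image \<gamma> \<subseteq> D \<times> UNIV"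
    and l: "(speed \<gamma> has_integral l) {0..1}"
    using assms by (auto simp: path_of_length_def)
  obtain F where F: "finite F"
    "\<And>u. u \<in> {0..1} - F \<Longrightarrow> (\<gamma> has_vector_derivative vector_derivative \<gamma> (at u)) (at u)"
    using valid_path_smooth_points[OF v] by blast
  have eq: "speed (reversepath \<gamma>) u = speed \<gamma> (1 - u)" if u: "u \<in> {0..1} - (-) 1 ` F" for u
  proof -
    have "1 - u \<notin> F" using u by (metis DiffE diff_diff_eq2 add_diff_cancel_left' image_eqI)
    then have d: "(\<gamma> has_vector_derivative vector_derivative \<gamma> (at (1 - u))) (at (1 - u))"
      using F(2) u by auto
    have "(\<gamma> \<circ> (\<lambda>u. 1 - u) has_vector_derivative (-1) *\<^sub>R vector_derivative \<gamma> (at (1 - u))) (at u)"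
      using d by (intro vector_diff_chain_at derivative_eq_intros | simp)+
    then have "(reversepath \<gamma> has_vector_derivative - vector_derivative \<gamma> (at (1 - u))) (at u)"
      by (simp add: reversepath_def o_def)
    then show ?thesis
      using speed_eq[OF d] speed_eq[of "reversepath \<gamma>" _ u] path_in_D[OF im, of "1 - u"] u
      by (simp add: reversepath_def)
  qed
  have "((\<lambda>u. speed \<gamma> (1 - u)) has_integral l) {0..1}"
    using has_integral_affinity01[OF l, of "-1" 1] by simp
  then have "(speed (reversepath \<gamma>) has_integral l) {0..1}"
    by (rule has_integral_spike_finite[OF _ eq, rotated -1]) (use F in auto)
  then show ?thesis
    using assms by (auto simp: path_of_length_def)
qed

lemma path_of_length_join:
  assumes "path_of_length \<gamma>1 l1 p q" and "path_of_length \<gamma>2 l2 q r"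
  shows "path_of_length (\<gamma>1 +++ \<gamma>2) (l1 + l2) p r"
proof -
  have v1: "valid_path \<gamma>1" and im1: "path_image \<gamma>1 \<subseteq> D \<times> UNIV"
    and l1: "(speed \<gamma>1 has_integral l1) {0..1}"
    and v2: "valid_path \<gamma>2" and im2: "path_image \<gamma>2 \<subseteq> D \<times> UNIV"
    and l2: "(speed \<gamma>2 has_integral l2) {0..1}"
    using assms by (auto simp: path_of_length_def)
  obtain F1 where F1: "finite F1"
    "\<And>u. u \<in> {0..1} - F1 \<Longrightarrow> (\<gamma>1 has_vector_derivative vector_derivative \<gamma>1 (at u)) (at u)"
    using valid_path_smooth_points[OF v1] by blast
  obtain F2 where F2: "finite F2"
    "\<And>u. u \<in> {0..1} - F2 \<Longrightarrow> (\<gamma>2 has_vector_derivative vector_derivative \<gamma>2 (at u)) (at u)"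
    using valid_path_smooth_points[OF v2] by blast
  have eq1: "speed (\<gamma>1 +++ \<gamma>2) u = 2 * speed \<gamma>1 (2 * u)"
    if u: "u \<in> {0..1/2} - insert (1/2) ((*) 2 -` F1)" for u
  proof -
    have d: "(\<gamma>1 has_vector_derivative vector_derivative \<gamma>1 (at (2 * u))) (at (2 * u))"
      using F1(2)[of "2 * u"] u by auto
    have c: "(\<gamma>1 \<circ> (\<lambda>u. 2 * u) has_vector_derivative 2 *\<^sub>R vector_derivative \<gamma>1 (at (2 * u))) (at u)"
      using d by (intro vector_diff_chain_at derivative_eq_intros | simp)+
    have "(\<gamma>1 +++ \<gamma>2 has_vector_derivative 2 *\<^sub>R vector_derivative \<gamma>1 (at (2 * u))) (at u)"
      by (rule has_vector_derivative_transform_within_open[OF c, of "{..<1/2}"])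
        (use u in \<open>auto simp: joinpaths_def\<close>)
    then show ?thesis
      using speed_eq[OF d] speed_eq[of "\<gamma>1 +++ \<gamma>2" _ u] path_in_D[OF im1, of "2 * u"] u
      by (simp add: joinpaths_def)
  qed
  have eq2: "speed (\<gamma>1 +++ \<gamma>2) u = 2 * speed \<gamma>2 (2 * u - 1)"
    if u: "u \<in> {1/2..1} - insert (1/2) ((\<lambda>u. 2 * u - 1) -` F2)" for u
  proof -
    have d: "(\<gamma>2 has_vector_derivative vector_derivative \<gamma>2 (at (2 * u - 1))) (at (2 * u - 1))"
      using F2(2)[of "2 * u - 1"] u by auto
    have c: "(\<gamma>2 \<circ> (\<lambda>u. 2 * u - 1) has_vector_derivative 2 *\<^sub>R vector_derivative \<gamma>2 (at (2 * u - 1))) (at u)"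
      using d by (intro vector_diff_chain_at derivative_eq_intros | simp)+
    have "(\<gamma>1 +++ \<gamma>2 has_vector_derivative 2 *\<^sub>R vector_derivative \<gamma>2 (at (2 * u - 1))) (at u)"
      by (rule has_vector_derivative_transform_within_open[OF c, of "{1/2<..}"])
        (use u in \<open>auto simp: joinpaths_def\<close>)
    then show ?thesis
      using speed_eq[OF d] speed_eq[of "\<gamma>1 +++ \<gamma>2" _ u] path_in_D[OF im2, of "2 * u - 1"] u
      by (simp add: joinpaths_def)
  qed
  have "((\<lambda>u. 2 * speed \<gamma>1 (2 * u)) has_integral l1) {0..1/2}"
    and "((\<lambda>u. 2 * speed \<gamma>2 (2 * u - 1)) has_integral l2) {1/2..1}"
    using has_integral_affinity01[OF l1, where m = 2 and c = 0, THEN has_integral_cmul[where c = 2]]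
          has_integral_affinity01[OF l2, where m = 2 and c = "-1", THEN has_integral_cmul[where c = 2]]
    by (simp_all only: image_affinity_atLeastAtMost_div_diff, simp_all)
  note i = this
  have "(speed (\<gamma>1 +++ \<gamma>2) has_integral l1) {0..1/2}"
    by (rule has_integral_spike_finite[where S = "insert (1/2) ((*) 2 -` F1)", OF _ eq1 i(1)])
      (auto intro!: finite_vimageI F1 inj_onI)
  moreover have "(speed (\<gamma>1 +++ \<gamma>2) has_integral l2) {1/2..1}"
    by (rule has_integral_spike_finite[where S = "insert (1/2) ((\<lambda>u. 2 * u - 1) -` F2)", OF _ eq2 i(2)])
      (auto intro!: finite_vimageI F2 inj_onI)
  ultimately have "(speed (\<gamma>1 +++ \<gamma>2) has_integral (l1 + l2)) {0..1}"
    using has_integral_combine[of 0 "1/2" 1] by simp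
  then show ?thesis
    using assms by (auto simp: path_of_length_def valid_path_join path_image_join)
qed

text \<open>
A path for upper estimates: where \<open>z \<ge> m\<close>, the speed of a Euclidean segment is at most \<open>1/m\<close> times its
Euclidean speed.
\<close>

lemma path_of_length_segment:
  assumes p: "fst p \<in> D" and q: "fst q \<in> D" and m: "0 < m"
    and zm: "\<And>s. s \<in> closed_segment (fst p) (fst q) \<Longrightarrow> m \<le> z s"
  obtains l where "path_of_length (linepath p q) l p q" and "l \<le> dist p q / m"
proof -
  have seg: "fst (linepath p q u) \<in> closed_segment (fst p) (fst q)" if "u \<in> {0..1}" for u
    using that by (auto simp: linepath_def closed_segment_def)
  have sub: "closed_segment (fst p) (fst q) \<subseteq> D"
    by (meson closed_segment_subset interval_D is_interval_convex p q)
  have d: "(linepath p q has_vector_derivative (q - p)) (at u)" for u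
    by (rule has_vector_derivative_linepath_within)
  have sp: "speed (linepath p q) u = dist p q / z (fst (linepath p q u))" if "u \<in> {0..1}" for u
    using speed_eq[OF d] seg[OF that] sub by (auto simp: dist_norm norm_minus_commute)
  have cz: "continuous_on D z"
    using z_deriv by (meson DERIV_isCont continuous_at_imp_continuous_on)
  have "continuous_on {0..1} (\<lambda>u. dist p q / z (fst (linepath p q u)))"
  proof (intro continuous_intros continuous_on_compose2[OF cz])
    show "(\<lambda>u. fst (linepath p q u)) ` {0..1} \<subseteq> D" using seg sub by auto
    show "\<forall>u\<in>{0..1}. z (fst (linepath p q u)) \<noteq> 0" using seg sub z_pos by (metis less_irrefl subsetD)
  qed
  then have "(\<lambda>u. dist p q / z (fst (linepath p q u))) integrable_on {0..1}"
    by (rule integrable_continuous_interval)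
  then obtain l where l: "((\<lambda>u. dist p q / z (fst (linepath p q u))) has_integral l) {0..1}" by blast
  then have l': "(speed (linepath p q) has_integral l) {0..1}"
    by (rule has_integral_eq[rotated]) (simp add: sp)
  show ?thesis
  proof
    show "path_of_length (linepath p q) l p q"
      unfolding path_of_length_def
    proof (intro conjI l')
      show "path_image (linepath p q) \<subseteq> D \<times> UNIV"
        unfolding path_image_def
      proof (rule image_subsetI)
        fix u :: real assume "u \<in> {0..1}"
        then show "linepath p q u \<in> D \<times> UNIV" using seg sub by (simp add: mem_Times_iff subset_iff)
      qed
    qed simp_all
    have "((\<lambda>u. dist p q / m) has_integral dist p q / m) {0..1::real}"
      using has_integral_const_real[of "dist p q / m" 0 1] by simp
    moreover have "dist p q / z (fst (linepath p q u)) \<le> dist p q / m" if "u \<in> {0..1}" for u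
      by (rule divide_left_mono)
        (use zm[OF seg[OF that]] m in \<open>auto intro: mult_pos_pos\<close>)
    ultimately show "l \<le> dist p q / m"
      by (intro has_integral_le[OF l]) auto
  qed
qed

lemma segment_z_bound:
  assumes "fst p \<in> D" and "fst q \<in> D"
  obtains m where "0 < m" and "\<And>s. s \<in> closed_segment (fst p) (fst q) \<Longrightarrow> m \<le> z s"
proof -
  have sub: "closed_segment (fst p) (fst q) \<subseteq> D"
    by (meson closed_segment_subset interval_D is_interval_convex assms)
  have cz: "continuous_on D z"
    using z_deriv by (meson DERIV_isCont continuous_at_imp_continuous_on)
  obtain s where "s \<in> closed_segment (fst p) (fst q)"
    "\<And>t. t \<in> closed_segment (fst p) (fst q) \<Longrightarrow> z s \<le> z t"
    using continuous_attains_inf[OF compact_segment _ continuous_on_subset[OF cz sub]] by auto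
  then show ?thesis using that[of "z s"] z_pos sub by blast
qed

lemma surface_dist_eq_Inf:
  "fst p \<in> D \<Longrightarrow> fst q \<in> D \<Longrightarrow> surface_dist p q = Inf {l. \<exists>\<gamma>. path_of_length \<gamma> l p q}"
  by (simp add: induced_distance_def path_of_length_def mem_Times_iff conj_assoc)

lemma surface_dist_le_length:
  assumes "fst p \<in> D" "fst q \<in> D" "path_of_length \<gamma> l p q"
  shows "surface_dist p q \<le> l"
  unfolding surface_dist_eq_Inf[OF assms(1,2)]
proof (rule cInf_lower)
  show "bdd_below {l. \<exists>\<gamma>. path_of_length \<gamma> l p q}"
    using path_of_length_nonneg by (intro bdd_belowI[of _ 0]) blast
qed (use assms(3) in blast)

lemma surface_dist_greatest:
  assumes "fst p \<in> D" "fst q \<in> D" "\<And>\<gamma> l. path_of_length \<gamma> l p q \<Longrightarrow> c \<le> l"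
  shows "c \<le> surface_dist p q"
proof -
  obtain m where "0 < m" "\<And>s. s \<in> closed_segment (fst p) (fst q) \<Longrightarrow> m \<le> z s"
    using segment_z_bound assms by blast
  then obtain l where "path_of_length (linepath p q) l p q"
    using path_of_length_segment assms by blast
  then have "{l. \<exists>\<gamma>. path_of_length \<gamma> l p q} \<noteq> {}" by blast
  then show ?thesis
    unfolding surface_dist_eq_Inf[OF assms(1,2)] by (rule cInf_greatest) (use assms in blast)
qed

lemma surface_dist_near:
  assumes "fst p \<in> D" "fst q \<in> D" "0 < e"
  obtains \<gamma> l where "path_of_length \<gamma> l p q" "l < surface_dist p q + e"
  using surface_dist_greatest[OF assms(1,2), of "surface_dist p q + e"] assms(3)
  by (meson less_add_same_cancel1 not_le)

lemma surface_dist_le_euclidean: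
  assumes "fst p \<in> D" "fst q \<in> D" "0 < m"
    and "\<And>s. s \<in> closed_segment (fst p) (fst q) \<Longrightarrow> m \<le> z s"
  shows "surface_dist p q \<le> dist p q / m"
  using path_of_length_segment[OF assms] surface_dist_le_length[OF assms(1,2)] by (metis order_trans)

text \<open>
The source of all lower estimates: a function whose gradient has norm at most 1 in the induced
metric cannot vary by more than the length of a path between two points.
\<close>

lemma potential_le_surface_dist:
  fixes H :: "real \<times> real \<Rightarrow> real"
  assumes p: "fst p \<in> D" and q: "fst q \<in> D"
    and H: "\<And>r. fst r \<in> D \<Longrightarrow> (H has_derivative H' r) (at r)"
    and bound: "\<And>r v. fst r \<in> D \<Longrightarrow> \<bar>H' r v\<bar> \<le> norm v / z (fst r)"
  shows "\<bar>H p - H q\<bar> \<le> surface_dist p q"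
proof (rule surface_dist_greatest[OF p q])
  fix \<gamma> l assume g: "path_of_length \<gamma> l p q"
  then have v: "valid_path \<gamma>" and im: "path_image \<gamma> \<subseteq> D \<times> UNIV"
    and l: "(speed \<gamma> has_integral l) {0..1}" and ends: "\<gamma> 0 = p" "\<gamma> 1 = q"
    by (auto simp: path_of_length_def pathstart_def pathfinish_def)
  obtain F where F: "finite F"
    "\<And>u. u \<in> {0..1} - F \<Longrightarrow> (\<gamma> has_vector_derivative vector_derivative \<gamma> (at u)) (at u)"
    using valid_path_smooth_points[OF v] by blast
  define f where "f u = (if u \<in> F then 0 else H' (\<gamma> u) (vector_derivative \<gamma> (at u)))" for u
  define g where "g u = (if u \<in> F then 0 else speed \<gamma> u)" for u
  have hd: "((H \<circ> \<gamma>) has_vector_derivative f u) (at u)" if u: "u \<in> {0..1} - F" for u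
  proof -
    have "(H has_derivative H' (\<gamma> u)) (at (\<gamma> u))" using H path_in_D[OF im] u by auto
    then have "((H \<circ> \<gamma>) has_derivative H' (\<gamma> u) \<circ> (\<lambda>t. t *\<^sub>R vector_derivative \<gamma> (at u))) (at u)"
      using F(2)[OF u] unfolding has_vector_derivative_def by (intro diff_chain_at)
    moreover have "bounded_linear (H' (\<gamma> u))"
      using \<open>(H has_derivative H' (\<gamma> u)) (at (\<gamma> u))\<close> by (rule has_derivative_bounded_linear)
    ultimately show ?thesis
      using u unfolding has_vector_derivative_def f_def
      by (simp add: o_def linear_simps)
  qed
  have cH: "continuous_on (D \<times> UNIV) H"
    using H by (intro continuous_at_imp_continuous_on ballI)
      (blast intro: has_derivative_continuous mem_Times_iff[THEN iffD1, THEN conjunct1])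
  have "continuous_on {0..1} \<gamma>"
    using v by (simp add: valid_path_imp_path path_def[symmetric])
  then have "continuous_on {0..1} (H \<circ> \<gamma>)"
    by (intro continuous_on_compose continuous_on_subset[OF cH]) (use im in \<open>auto simp: path_image_def\<close>)
  from fundamental_theorem_of_calculus_strong[OF F(1) _ hd this]
  have f: "(f has_integral (H q - H p)) {0..1}" using ends by simp
  have g: "(g has_integral l) {0..1}"
    by (rule has_integral_spike_finite[OF F(1) _ l]) (simp add: g_def)
  have "norm (integral {0..1} f) \<le> integral {0..1} g"
  proof (rule integral_norm_bound_integral)
    fix u :: real assume u: "u \<in> {0..1}"
    show "norm (f u) \<le> g u"
      using speed_eq[OF F(2), of u] path_in_D[OF im u] bound[of "\<gamma> u"] u
      by (auto simp: f_def g_def)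
  qed (use f g in blast)+
  then show "\<bar>H p - H q\<bar> \<le> l"
    using integral_unique[OF f] integral_unique[OF g] by simp
qed

lemma fst_le_surface_dist:
  assumes p: "fst p \<in> D" and q: "fst q \<in> D"
  shows "\<bar>fst p - fst q\<bar> \<le> M * surface_dist p q"
proof -
  have M: "0 < M" using z_pos[OF p] z_le[OF p] by simp
  have "\<bar>fst p / M - fst q / M\<bar> \<le> surface_dist p q"
  proof (rule potential_le_surface_dist[OF p q, where H' = "\<lambda>r v. fst v / M"])
    fix r v :: "real \<times> real" assume r: "fst r \<in> D"
    show "((\<lambda>r. fst r / M) has_derivative (\<lambda>v. fst v / M)) (at r)"
      using M by (auto intro!: derivative_eq_intros)
    have "\<bar>fst v\<bar> \<le> norm v" by (metis norm_fst_le prod.collapse real_norm_def)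
    then show "\<bar>fst v / M\<bar> \<le> norm v / z (fst r)"
      using M z_pos[OF r] z_le[OF r] by (auto intro!: frac_le)
  qed
  then show ?thesis using M by (simp add: diff_divide_distrib[symmetric] divide_simps mult.commute)
qed

lemma snd_le_surface_dist:
  assumes p: "fst p \<in> D" and q: "fst q \<in> D"
  shows "\<bar>snd p - snd q\<bar> \<le> M * surface_dist p q"
proof -
  have M: "0 < M" using z_pos[OF p] z_le[OF p] by simp
  have "\<bar>snd p / M - snd q / M\<bar> \<le> surface_dist p q"
  proof (rule potential_le_surface_dist[OF p q, where H' = "\<lambda>r v. snd v / M"])
    fix r v :: "real \<times> real" assume r: "fst r \<in> D"
    show "((\<lambda>r. snd r / M) has_derivative (\<lambda>v. snd v / M)) (at r)"
      using M by (auto intro!: derivative_eq_intros)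
    have "\<bar>snd v\<bar> \<le> norm v" by (metis norm_snd_le prod.collapse real_norm_def)
    then show "\<bar>snd v / M\<bar> \<le> norm v / z (fst r)"
      using M z_pos[OF r] z_le[OF r] by (auto intro!: frac_le)
  qed
  then show ?thesis using M by (simp add: diff_divide_distrib[symmetric] divide_simps mult.commute)
qed

lemma Metric_space_surface_dist: "Metric_space (D \<times> UNIV) surface_dist"
proof
  fix p q r :: "real \<times> real"
  show nonneg: "0 \<le> surface_dist p q"
  proof (cases "fst p \<in> D \<and> fst q \<in> D")
    case True
    then show ?thesis by (intro surface_dist_greatest) (auto intro: path_of_length_nonneg)
  qed (auto simp: induced_distance_def mem_Times_iff)
  show "surface_dist p q = surface_dist q p"
  proof (cases "fst p \<in> D \<and> fst q \<in> D")
    case True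
    then show ?thesis
      by (intro antisym surface_dist_greatest) (auto intro: surface_dist_le_length path_of_length_reverse)
  qed (auto simp: induced_distance_def mem_Times_iff)
  show "surface_dist p q = 0 \<longleftrightarrow> p = q" if "p \<in> D \<times> UNIV" "q \<in> D \<times> UNIV"
  proof
    assume "surface_dist p q = 0"
    then show "p = q" using fst_le_surface_dist[of p q] snd_le_surface_dist[of p q] that by (auto intro: prod_eqI)
  next
    assume "p = q"
    moreover have "fst p \<in> D" using that by (simp add: mem_Times_iff)
    moreover from segment_z_bound[OF this this]
    obtain m where "0 < m" "\<And>s. s \<in> closed_segment (fst p) (fst p) \<Longrightarrow> m \<le> z s" by blast
    ultimately have "surface_dist p q \<le> dist p q / m" using that surface_dist_le_euclidean[of p p m] by (auto simp: mem_Times_iff)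
    then show "surface_dist p q = 0" using \<open>p = q\<close> nonneg by simp
  qed
  show "surface_dist p r \<le> surface_dist p q + surface_dist q r"
    if "p \<in> D \<times> UNIV" "q \<in> D \<times> UNIV" "r \<in> D \<times> UNIV"
  proof (rule field_le_epsilon)
    fix e :: real assume e: "0 < e"
    have in_D: "fst p \<in> D" "fst q \<in> D" "fst r \<in> D" using that by (auto simp: mem_Times_iff)
    obtain \<gamma>1 l1 where 1: "path_of_length \<gamma>1 l1 p q" "l1 < surface_dist p q + e / 2"
      using surface_dist_near[OF in_D(1,2), of "e / 2"] e by auto
    obtain \<gamma>2 l2 where 2: "path_of_length \<gamma>2 l2 q r" "l2 < surface_dist q r + e / 2"
      using surface_dist_near[OF in_D(2,3), of "e / 2"] e by auto
    show "surface_dist p r \<le> surface_dist p q + surface_dist q r + e"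
      using surface_dist_le_length[OF in_D(1,3) path_of_length_join[OF 1(1) 2(1)]] 1(2) 2(2) by simp
  qed
qed

text \<open>
A Cauchy sequence stays in a sublevel set of \<open>\<bar>h\<bar>\<close>, because \<open>h\<close> is 1-Lipschitz. By properness its first
coordinates stay in a compact part of \<open>D\<close>. On this part the induced distance is equivalent to the
Euclidean one, and the Euclidean limit is a limit.
\<close>

lemma complete_if_proper_potential:
  assumes h: "\<And>s. s \<in> D \<Longrightarrow> (h has_real_derivative h' s) (at s)"
    and h': "\<And>s. s \<in> D \<Longrightarrow> \<bar>h' s\<bar> \<le> 1 / z s"
    and proper: "\<And>C. \<exists>c d. {c..d} \<subseteq> D \<and> {s \<in> D. \<bar>h s\<bar> \<le> C} \<subseteq> {c..d}"
  shows "complete_surface D x z"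
proof -
  interpret M: Metric_space "D \<times> UNIV" surface_dist by (rule Metric_space_surface_dist)
  have h_surface_dist: "\<bar>h (fst p) - h (fst q)\<bar> \<le> surface_dist p q" if "fst p \<in> D" "fst q \<in> D" for p q
  proof (rule potential_le_surface_dist[OF that, where H' = "\<lambda>r v. h' (fst r) * fst v"])
    fix r v :: "real \<times> real" assume r: "fst r \<in> D"
    show "((\<lambda>r. h (fst r)) has_derivative (\<lambda>v. h' (fst r) * fst v)) (at r)"
      using has_derivative_compose[OF has_derivative_fst[OF has_derivative_ident]
          h[OF r, unfolded has_field_derivative_def]] .
    have "\<bar>fst v\<bar> \<le> norm v" by (metis norm_fst_le prod.collapse real_norm_def)
    then have "\<bar>h' (fst r)\<bar> * \<bar>fst v\<bar> \<le> 1 / z (fst r) * norm v"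
      using h'[OF r] z_pos[OF r] by (intro mult_mono) auto
    then show "\<bar>h' (fst r) * fst v\<bar> \<le> norm v / z (fst r)" by (simp add: abs_mult)
  qed
  show ?thesis
    unfolding complete_surface_def M.mcomplete_def
  proof (intro allI impI)
    fix \<sigma> assume "M.MCauchy \<sigma>"
    then have "range \<sigma> \<subseteq> D \<times> UNIV"
      and cau: "\<And>e. 0 < e \<Longrightarrow> \<exists>N. \<forall>n n'. N \<le> n \<longrightarrow> N \<le> n' \<longrightarrow> surface_dist (\<sigma> n) (\<sigma> n') < e"
      by (auto simp: M.MCauchy_def)
    then have \<sigma>D: "fst (\<sigma> n) \<in> D" for n by (metis mem_Times_iff range_subsetD)
    have M: "0 < M" using z_pos[OF \<sigma>D] z_le[OF \<sigma>D] by (meson less_le_trans)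
    obtain N1 where N1: "\<And>n. N1 \<le> n \<Longrightarrow> surface_dist (\<sigma> N1) (\<sigma> n) < 1" using cau[of 1] by fastforce
    define C where "C = \<bar>h (fst (\<sigma> N1))\<bar> + 1"
    obtain c d where cd: "{c..d} \<subseteq> D" "{s \<in> D. \<bar>h s\<bar> \<le> C} \<subseteq> {c..d}" using proper by blast
    have in_cd: "fst (\<sigma> n) \<in> {c..d}" if "N1 \<le> n" for n
    proof -
      have "\<bar>h (fst (\<sigma> n))\<bar> \<le> C"
        using h_surface_dist[OF \<sigma>D \<sigma>D, of N1 n] N1[OF that] unfolding C_def by linarith
      then show ?thesis using cd(2) \<sigma>D by blast
    qed
    have "Cauchy \<sigma>"
      unfolding Cauchy_def
    proof (intro allI impI)
      fix e :: real assume e: "0 < e"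
      obtain N where N: "\<And>n n'. N \<le> n \<Longrightarrow> N \<le> n' \<Longrightarrow> surface_dist (\<sigma> n) (\<sigma> n') < e / (2 * M)"
        using cau[of "e / (2 * M)"] e M by auto
      have "dist (\<sigma> n) (\<sigma> n') < e" if "N \<le> n" "N \<le> n'" for n n'
      proof -
        have "M * surface_dist (\<sigma> n) (\<sigma> n') < e / 2"
          using N[OF that] M by (simp add: field_simps)
        then have "\<bar>fst (\<sigma> n) - fst (\<sigma> n')\<bar> + \<bar>snd (\<sigma> n) - snd (\<sigma> n')\<bar> < e"
          using fst_le_surface_dist[OF \<sigma>D \<sigma>D, of n n'] snd_le_surface_dist[OF \<sigma>D \<sigma>D, of n n'] by linarith
        moreover have "dist (\<sigma> n) (\<sigma> n') \<le> \<bar>fst (\<sigma> n) - fst (\<sigma> n')\<bar> + \<bar>snd (\<sigma> n) - snd (\<sigma> n')\<bar>"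
          by (simp add: dist_prod_def dist_real_def sqrt_sum_squares_le_sum_abs)
        ultimately show ?thesis by linarith
      qed
      then show "\<exists>N. \<forall>m\<ge>N. \<forall>n\<ge>N. dist (\<sigma> m) (\<sigma> n) < e" by blast
    qed
    then obtain p where p: "\<sigma> \<longlonglongrightarrow> p" using Cauchy_convergent convergent_def by blast
    have pcd: "fst p \<in> {c..d}"
    proof (rule closed_sequentially[OF closed_atLeastAtMost, of "\<lambda>n. fst (\<sigma> (n + N1))"])
      show "(\<lambda>n. fst (\<sigma> (n + N1))) \<longlonglongrightarrow> fst p"
        by (intro tendsto_fst LIMSEQ_ignore_initial_segment p)
    qed (simp only: in_cd le_add2)
    then have pD: "fst p \<in> D" using cd by blast
    have "continuous_on {c..d} z"
      using cd(1) z_deriv by (intro continuous_at_imp_continuous_on ballI DERIV_isCont) blast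
    then obtain s0 where s0: "s0 \<in> {c..d}" "\<And>s. s \<in> {c..d} \<Longrightarrow> z s0 \<le> z s"
      using continuous_attains_inf[of "{c..d}" z] pcd by auto
    have m: "0 < z s0" using s0 cd z_pos by blast
    have ub: "surface_dist (\<sigma> n) p \<le> dist (\<sigma> n) p / z s0" if "N1 \<le> n" for n
    proof (rule surface_dist_le_euclidean[OF \<sigma>D pD m])
      fix s assume "s \<in> closed_segment (fst (\<sigma> n)) (fst p)"
      then have "s \<in> {c..d}"
        using in_cd[OF that] pcd by (metis closed_segment_subset convex_real_interval(5) subsetD)
      then show "z s0 \<le> z s" by (rule s0)
    qed
    have "limitin M.mtopology \<sigma> p sequentially"
      unfolding M.limit_metric_sequentially
    proof (intro conjI allI impI)
      show "p \<in> D \<times> UNIV" using pD by (simp add: mem_Times_iff)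
      fix e :: real assume "0 < e"
      then obtain N where N: "\<And>n. N \<le> n \<Longrightarrow> dist (\<sigma> n) p < e * z s0"
        using p m unfolding LIMSEQ_def by (metis mult_pos_pos)
      have "surface_dist (\<sigma> n) p < e" if "max N N1 \<le> n" for n
      proof -
        have "dist (\<sigma> n) p / z s0 < e" using N[of n] that m by (simp add: divide_simps)
        then show ?thesis using ub[of n] that by simp
      qed
      then show "\<exists>N. \<forall>n\<ge>N. \<sigma> n \<in> D \<times> UNIV \<and> surface_dist (\<sigma> n) p < e"
        using \<sigma>D by (intro exI[of _ "max N N1"]) (simp add: mem_Times_iff)
    qed
    then show "\<exists>p. limitin M.mtopology \<sigma> p sequentially" ..
  qed
qed

text \<open>
At a finite end where \<open>z\<close> is bounded away from 0, a sequence of parameters converging to the end is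
Cauchy for the induced distance; its only possible limit has the parameter \<open>B\<close>, which is not in \<open>D\<close>.
\<close>

lemma incomplete_if_end_at_positive_height:
  assumes B: "D = {-B<..<B}" "0 < B" and m: "0 < m" "\<And>s. s \<in> D \<Longrightarrow> m \<le> z s"
  shows "\<not> complete_surface D x z"
proof
  interpret M: Metric_space "D \<times> UNIV" surface_dist by (rule Metric_space_surface_dist)
  define s where "s n = B * (1 - inverse (real (Suc n)))" for n
  have lim: "s \<longlonglongrightarrow> B"
    using tendsto_mult[OF tendsto_const[of B] tendsto_diff[OF tendsto_const[of 1] LIMSEQ_inverse_real_of_nat]]
    by (simp add: s_def[abs_def])
  have sD: "s n \<in> D" for n
  proof -
    have "inverse (real (Suc n)) \<le> 1" "0 < inverse (real (Suc n))" by (auto simp: inverse_le_1_iff)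
    then have "0 \<le> s n" "s n < B" using B(2) by (simp_all add: s_def)
    then show ?thesis using B by auto
  qed
  assume "complete_surface D x z"
  moreover have "M.MCauchy (\<lambda>n. (s n, 0))"
    unfolding M.MCauchy_def
  proof (intro conjI allI impI)
    show "range (\<lambda>n. (s n, 0)) \<subseteq> D \<times> UNIV" using sD by auto
    fix e :: real assume e: "0 < e"
    obtain N where N: "\<And>n n'. N \<le> n \<Longrightarrow> N \<le> n' \<Longrightarrow> dist (s n) (s n') < e * m"
      using LIMSEQ_imp_Cauchy[OF lim] e m(1) unfolding Cauchy_def by (meson mult_pos_pos)
    have "surface_dist (s n, 0) (s n', 0) < e" if "N \<le> n" "N \<le> n'" for n n'
    proof -
      have "surface_dist (s n, 0) (s n', 0) \<le> dist (s n, 0::real) (s n', 0) / m"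
      proof (rule surface_dist_le_euclidean)
        fix u assume "u \<in> closed_segment (fst (s n, 0::real)) (fst (s n', 0::real))"
        then have "u \<in> D"
          using sD by (metis closed_segment_subset fst_conv interval_D is_interval_convex subsetD)
        then show "m \<le> z u" by (rule m)
      qed (use sD m in auto)
      also have "\<dots> = dist (s n) (s n') / m" by (simp add: dist_Pair_Pair)
      also have "\<dots> < e" using N[OF that] m(1) by (simp add: divide_simps)
      finally show ?thesis .
    qed
    then show "\<exists>N. \<forall>n n'. N \<le> n \<longrightarrow> N \<le> n' \<longrightarrow> surface_dist (s n, 0) (s n', 0) < e" by blast
  qed
  ultimately obtain p where "limitin M.mtopology (\<lambda>n. (s n, 0)) p sequentially"
    unfolding complete_surface_def M.mcomplete_def by blast
  then have p: "fst p \<in> D" and lim': "\<And>e. 0 < e \<Longrightarrow> \<exists>N. \<forall>n\<ge>N. surface_dist (s n, 0) p < e"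
    unfolding M.limit_metric_sequentially by (auto simp: mem_Times_iff) metis
  have M: "0 < M" using z_pos[OF p] z_le[OF p] by simp
  have "s \<longlonglongrightarrow> fst p"
    unfolding LIMSEQ_def
  proof (intro allI impI)
    fix e :: real assume e: "0 < e"
    obtain N where N: "\<forall>n\<ge>N. surface_dist (s n, 0) p < e / M" using lim'[of "e / M"] e M by auto
    have "dist (s n) (fst p) < e" if "N \<le> n" for n
    proof -
      have "dist (s n) (fst p) \<le> M * surface_dist (s n, 0) p"
        using fst_le_surface_dist[of "(s n, 0)" p] sD p by (simp add: dist_real_def)
      also have "\<dots> < e" using N that M by (simp add: field_simps)
      finally show ?thesis .
    qed
    then show "\<exists>N. \<forall>n\<ge>N. dist (s n) (fst p) < e" by blast
  qed
  then have "fst p = B" using lim LIMSEQ_unique by blast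
  then show False using p B by simp
qed

end

section \<open>First integral and angle parametrization\<close>

lemma same_sign_on_connected:
  fixes f :: "'a::topological_space \<Rightarrow> real"
  assumes "connected S" and "continuous_on S f" and nz: "\<And>u. u \<in> S \<Longrightarrow> f u \<noteq> 0"
    and "u \<in> S" and "v \<in> S"
  shows "0 < f u * f v"
proof -
  have c: "connected (f ` S)" using assms(1,2) by (rule connected_continuous_image[rotated])
  have i: "f u \<in> f ` S" "f v \<in> f ` S" using assms(4,5) by auto
  have no0: "0 \<notin> f ` S" using nz by (metis imageE)
  have "f u \<noteq> 0" "f v \<noteq> 0" using nz assms(4,5) by auto
  moreover have "\<not> (f u \<le> 0 \<and> 0 \<le> f v)" "\<not> (f v \<le> 0 \<and> 0 \<le> f u)"
    using connectedD_interval[OF c i] connectedD_interval[OF c i(2,1)] no0 by auto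
  ultimately show ?thesis by (auto simp: zero_less_mult_iff)
qed

lemma is_interval_einterval: "is_interval (einterval c d)"
  unfolding is_interval_1
proof (intro ballI allI impI)
  fix u v w :: real assume "u \<in> einterval c d" "v \<in> einterval c d" "u \<le> w \<and> w \<le> v"
  then have "c < ereal u" "ereal u \<le> ereal w" "ereal w \<le> ereal v" "ereal v < d"
    by (auto simp: einterval_iff)
  then show "w \<in> einterval c d"
    unfolding einterval_iff by (meson le_less_trans less_le_trans)
qed

lemma antiderivative_on_einterval:
  fixes f :: "real \<Rightarrow> real"
  assumes "continuous_on (einterval c d) f" and "0 \<in> einterval c d"
  obtains F where "F 0 = 0" and "\<And>u. u \<in> einterval c d \<Longrightarrow> (F has_real_derivative f u) (at u)"
proof -
  have "c < d" using assms(2) by (auto simp: einterval_def)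
  then obtain F where F: "\<And>u::real. c < u \<Longrightarrow> u < d \<Longrightarrow> (F has_vector_derivative f u) (at u)"
    using einterval_antiderivative[of c d f] assms(1)
    by (auto simp: continuous_on_eq_continuous_at einterval_iff)
  show ?thesis
  proof (rule that[of "\<lambda>u. F u - F 0"])
    show "F 0 - F 0 = 0" by simp
    show "((\<lambda>u. F u - F 0) has_real_derivative f u) (at u)" if "u \<in> einterval c d" for u
    proof -
      have "(F has_real_derivative f u) (at u)"
        using F[of u] that by (simp add: einterval_iff has_real_derivative_iff_has_vector_derivative)
      then show ?thesis by (auto intro!: derivative_eq_intros)
    qed
  qed
qed

lemma has_real_derivative_left_inverse:
  fixes f g :: "real \<Rightarrow> real"
  assumes "open S" and "u \<in> S" and "continuous_on S f" and "\<And>v. v \<in> S \<Longrightarrow> g (f v) = v"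
    and f': "(f has_real_derivative f') (at u)" "f' \<noteq> 0"
  shows "(g has_real_derivative inverse f') (at (f u))"
  unfolding has_field_derivative_def
proof (rule has_derivative_inverse_strong[OF assms(1-4)])
  show "(f has_derivative (*) f') (at u)" using f'(1) by (simp add: has_field_derivative_def)
  show "(*) f' \<circ> (*) (inverse f') = id" using f'(2) by (auto simp: fun_eq_iff)
qed

lemma zero_derivative_eq_on_interval:
  fixes f :: "real \<Rightarrow> real"
  assumes "is_interval S" and "\<And>u. u \<in> S \<Longrightarrow> (f has_real_derivative 0) (at u)"
    and "u \<in> S" and "v \<in> S"
  shows "f u = f v"
proof -
  obtain c where "\<And>w. w \<in> S \<Longrightarrow> f w = c"
    using has_field_derivative_zero_constant[of S f] assms(1,2)
    by (meson has_field_derivative_at_within is_interval_convex)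
  then show ?thesis using assms(3,4) by simp
qed

text \<open>
With the functions \<open>A\<close> and \<open>N\<close> below, the Weingarten equation is \<open>A(\<theta>) z \<theta>' = N(\<theta>)\<close>.
\<close>

locale weingarten_curve =
  fixes a b z0 :: real and D :: "real set" and x z \<theta> :: "real \<Rightarrow> real"
  assumes a_pos: "0 < a" and a_less: "a < 1" and z0_pos: "0 < z0"
    and maximal: "maximal_weingarten_profile a b z0 D x z \<theta>"
begin

definition A :: "real \<Rightarrow> real" where "A \<phi> = a / 2 + b * cos \<phi>"
definition N :: "real \<Rightarrow> real" where "N \<phi> = 1 - a * cos \<phi> + b * (sin \<phi>)\<^sup>2"
text \<open>
The value of the first integral \<open>N(\<theta>) / z\<^sup>2\<close>, computed at the initial point.
\<close>

definition k :: real where "k = (1 - a) / z0\<^sup>2"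
text \<open>
The height that the first integral forces on a point of the curve with angle \<open>\<phi>\<close>.
\<close>

definition height :: "real \<Rightarrow> real" where "height \<phi> = sqrt (N \<phi> / k)"

lemma k_pos: "0 < k" using a_less z0_pos by (simp add: k_def)

lemma A_cont: "continuous_on S A" unfolding A_def[abs_def] by (intro continuous_intros)

lemma N_deriv: "(N has_real_derivative 2 * sin \<phi> * A \<phi>) (at \<phi>)"
  unfolding N_def[abs_def] A_def by (auto intro!: derivative_eq_intros simp: algebra_simps)

text \<open>
The right-hand side shows how \<open>N\<close> and \<open>A\<close> compete: if \<open>N\<close> vanishes, then \<open>(2 A)\<^sup>2\<close> is the discriminant
\<open>a\<^sup>2 + 4 b\<^sup>2 + 4 b\<close>, and where \<open>A\<close> vanishes, the sign of \<open>b N\<close> is that of the discriminant.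
\<close>

lemma square_A: "(2 * A \<phi>)\<^sup>2 = a\<^sup>2 + 4 * b\<^sup>2 + 4 * b - 4 * b * N \<phi>"
proof -
  have "(2 * A \<phi>)\<^sup>2 = a\<^sup>2 + 4 * a * b * cos \<phi> + 4 * b\<^sup>2 * (1 - (sin \<phi>)\<^sup>2)"
    unfolding A_def cos_squared_eq[symmetric] by (simp add: power2_eq_square algebra_simps)
  then show ?thesis unfolding N_def by (simp add: power2_eq_square algebra_simps)
qed

lemma height_square: "0 < N \<phi> \<Longrightarrow> k * (height \<phi>)\<^sup>2 = N \<phi>"
  using k_pos by (simp add: height_def)

lemma height_pos: "0 < N \<phi> \<Longrightarrow> 0 < height \<phi>"
  using k_pos by (simp add: height_def)

lemma height_deriv:
  assumes "0 < N \<phi>"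
  shows "(height has_real_derivative sin \<phi> * A \<phi> / (k * height \<phi>)) (at \<phi>)"
proof -
  have h: "0 < N \<phi> / k" using assms k_pos by simp
  have "((\<lambda>\<phi>. N \<phi> / k) has_real_derivative 2 * sin \<phi> * A \<phi> / k) (at \<phi>)"
    using N_deriv by (rule DERIV_cdivide)
  from DERIV_chain2[OF DERIV_real_sqrt[OF h] this]
  show ?thesis
    unfolding height_def[abs_def] using k_pos by (simp add: divide_simps mult.commute)
qed

lemma profile: "weingarten_profile a b z0 D x z \<theta>"
  using maximal by (simp add: maximal_weingarten_profile_def)

lemma open_D: "open D" and interval_D: "is_interval D" and zero_in_D: "0 \<in> D"
  and x_0: "x 0 = 0" and z_0: "z 0 = z0" and theta_0: "\<theta> 0 = 0"
  using profile by (auto simp: weingarten_profile_def)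

lemma z_pos: "s \<in> D \<Longrightarrow> 0 < z s"
  and x_deriv: "s \<in> D \<Longrightarrow> (x has_real_derivative cos (\<theta> s)) (at s)"
  and z_deriv: "s \<in> D \<Longrightarrow> (z has_real_derivative sin (\<theta> s)) (at s)"
  and theta_deriv': "s \<in> D \<Longrightarrow> (\<theta> has_real_derivative deriv \<theta> s) (at s)"
  and weingarten: "s \<in> D \<Longrightarrow> a * mean_curvature z \<theta> s + b * gauss_curvature z \<theta> s = 1"
  using profile by (auto simp: weingarten_profile_def DERIV_deriv_iff_real_differentiable)

lemma ode:
  assumes "s \<in> D"
  shows "A (\<theta> s) * z s * deriv \<theta> s = N (\<theta> s)"
proof -
  have s2: "(sin (\<theta> s))\<^sup>2 = 1 - cos (\<theta> s) * cos (\<theta> s)"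
    using sin_squared_eq[of "\<theta> s"] by (simp add: power2_eq_square)
  then show ?thesis
    using weingarten[OF assms]
    unfolding mean_curvature_def gauss_curvature_def principal_curvature1_def
      principal_curvature2_def A_def N_def s2
    by (simp add: field_simps)
qed

lemma theta_cont: "continuous_on D \<theta>" and z_cont: "continuous_on D z" and x_cont: "continuous_on D x"
  using theta_deriv' z_deriv x_deriv
  by (meson DERIV_isCont continuous_at_imp_continuous_on)+

text \<open>
The derivative of \<open>N(\<theta>) / z\<^sup>2\<close> has the factor \<open>A z \<theta>' - N\<close>, by \<open>dN/d\<theta> = 2 A sin \<theta>\<close> and \<open>z' = sin \<theta>\<close>.
\<close>

lemma first_integral:
  assumes s: "s \<in> D"
  shows "N (\<theta> s) = k * (z s)\<^sup>2"
proof -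
  have "N (\<theta> s) / (z s)\<^sup>2 = N (\<theta> 0) / (z 0)\<^sup>2"
  proof (rule zero_derivative_eq_on_interval[OF interval_D _ s zero_in_D])
    fix u assume u: "u \<in> D"
    have "((\<lambda>u. N (\<theta> u) / (z u)\<^sup>2) has_real_derivative
        (2 * sin (\<theta> u) * A (\<theta> u) * deriv \<theta> u * (z u)\<^sup>2 - N (\<theta> u) * (2 * z u * sin (\<theta> u)))
          / ((z u)\<^sup>2 * (z u)\<^sup>2)) (at u)"
      using z_pos[OF u]
      by (auto intro!: derivative_eq_intros DERIV_chain2[OF N_deriv] theta_deriv'[OF u] z_deriv[OF u])
    moreover have "2 * sin (\<theta> u) * A (\<theta> u) * deriv \<theta> u * (z u)\<^sup>2 - N (\<theta> u) * (2 * z u * sin (\<theta> u)) = 0"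
      unfolding ode[OF u, symmetric] by (simp add: power2_eq_square)
    ultimately show "((\<lambda>u. N (\<theta> u) / (z u)\<^sup>2) has_real_derivative 0) (at u)" by simp
  qed
  also have "\<dots> = k" by (simp add: N_def theta_0 z_0 k_def)
  finally show ?thesis using z_pos[OF s] by (simp add: field_simps)
qed

lemma N_pos: "s \<in> D \<Longrightarrow> 0 < N (\<theta> s)"
  using first_integral[of s] z_pos[of s] k_pos by simp

lemma A_nonzero: "s \<in> D \<Longrightarrow> A (\<theta> s) \<noteq> 0"
  using ode[of s] N_pos[of s] by auto

lemma z_eq_height: "s \<in> D \<Longrightarrow> z s = height (\<theta> s)"
  using first_integral[of s] z_pos[of s] k_pos by (simp add: height_def real_sqrt_unique)

lemma theta_deriv:
  assumes s: "s \<in> D"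
  shows "(\<theta> has_real_derivative k * z s / A (\<theta> s)) (at s)"
proof -
  have "deriv \<theta> s = k * z s / A (\<theta> s)"
    using ode[OF s] first_integral[OF s] A_nonzero[OF s] z_pos[OF s]
    by (simp add: field_simps power2_eq_square)
  then show ?thesis using theta_deriv'[OF s] by simp
qed

text \<open>
A zero of \<open>A\<close> on the curve would be a zero of \<open>N = A z \<theta>'\<close>, which is positive. So the sign of \<open>\<theta>'\<close> never
changes.
\<close>

lemma A_same_sign: "s \<in> D \<Longrightarrow> 0 < A (\<theta> s) * A 0"
  using same_sign_on_connected[of D "\<lambda>s. A (\<theta> s)" s 0] interval_D zero_in_D A_nonzero theta_0
    continuous_on_compose2[OF A_cont theta_cont, of UNIV]
  by (auto simp: is_interval_connected_1)

text \<open>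
Used with a zero \<open>\<beta>\<close> of \<open>A\<close>, of \<open>N\<close> or of the cosine: the connected range of \<open>\<theta>\<close> contains 0 and cannot
jump over \<open>\<beta>\<close> or \<open>- \<beta>\<close>.
\<close>

lemma theta_confined:
  assumes "0 < \<beta>" and "\<And>s. s \<in> D \<Longrightarrow> \<theta> s \<noteq> \<beta>" and "\<And>s. s \<in> D \<Longrightarrow> \<theta> s \<noteq> - \<beta>"
    and s: "s \<in> D"
  shows "\<bar>\<theta> s\<bar> < \<beta>"
proof (rule ccontr)
  assume n: "\<not> \<bar>\<theta> s\<bar> < \<beta>"
  have c: "connected (\<theta> ` D)"
    using theta_cont interval_D by (simp add: connected_continuous_image is_interval_connected_1)
  have 0: "0 \<in> \<theta> ` D" using theta_0 zero_in_D by force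
  have "\<beta> \<in> \<theta> ` D \<or> - \<beta> \<in> \<theta> ` D"
  proof (cases "0 \<le> \<theta> s")
    case True
    then show ?thesis using connectedD_interval[OF c 0, of "\<theta> s" \<beta>] n s assms(1) by auto
  next
    case False
    then show ?thesis using connectedD_interval[OF c _ 0, of "\<theta> s" "- \<beta>"] n s assms(1) by auto
  qed
  then show False using assms(2,3) by (metis imageE)
qed

text \<open>
Since \<open>z\<close> is a function of \<open>\<theta>\<close>, the equation \<open>\<theta>' = k z / A(\<theta>)\<close> is separable: the primitive \<open>\<tau>\<close> of
\<open>A / (k height)\<close> that vanishes at 0 satisfies \<open>\<tau> (\<theta> s) = s\<close>. The inverse of \<open>\<tau>\<close> on the whole interval
\<open>J\<close> is itself the angle of a profile that extends the given one. By maximality both have the same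
domain, so every angle in \<open>J\<close> is attained.
\<close>

lemma time_map:
  fixes c d :: ereal
  defines "J \<equiv> einterval c d"
  assumes J0: "0 \<in> J" and J: "\<And>\<phi>. \<phi> \<in> J \<Longrightarrow> A \<phi> \<noteq> 0 \<and> 0 < N \<phi>" and sub: "\<theta> ` D \<subseteq> J"
  obtains \<tau> X where "\<tau> 0 = 0" and "X 0 = 0"
    and "\<And>\<phi>. \<phi> \<in> J \<Longrightarrow> (\<tau> has_real_derivative A \<phi> / (k * height \<phi>)) (at \<phi>)"
    and "\<And>\<phi>. \<phi> \<in> J \<Longrightarrow> (X has_real_derivative cos \<phi> * (A \<phi> / (k * height \<phi>))) (at \<phi>)"
    and "\<And>s. s \<in> D \<Longrightarrow> \<tau> (\<theta> s) = s" and "\<And>s. s \<in> D \<Longrightarrow> x s = X (\<theta> s)"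
    and "\<And>\<phi>. \<phi> \<in> J \<Longrightarrow> \<tau> \<phi> \<in> D" and "\<And>\<phi>. \<phi> \<in> J \<Longrightarrow> \<theta> (\<tau> \<phi>) = \<phi>"
proof -
  have openJ: "open J" by (simp add: J_def)
  have intJ: "is_interval J" unfolding J_def by (rule is_interval_einterval)
  then have connJ: "connected J" by (simp add: is_interval_connected_1)
  have heightJ: "\<And>\<phi>. \<phi> \<in> J \<Longrightarrow> 0 < height \<phi>" using J height_pos by blast
  have height_cont: "continuous_on J height"
    using J height_deriv by (meson DERIV_isCont continuous_at_imp_continuous_on)
  have F_cont: "continuous_on J (\<lambda>\<phi>. A \<phi> / (k * height \<phi>))"
    by (intro continuous_intros A_cont height_cont) (use heightJ k_pos in fastforce)
  have G_cont: "continuous_on J (\<lambda>\<phi>. cos \<phi> * (A \<phi> / (k * height \<phi>)))"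
    by (rule continuous_on_mult[OF continuous_on_cos[OF continuous_on_id] F_cont])
  obtain \<tau> where \<tau>0: "\<tau> 0 = 0"
    and \<tau>: "\<And>\<phi>. \<phi> \<in> J \<Longrightarrow> (\<tau> has_real_derivative A \<phi> / (k * height \<phi>)) (at \<phi>)"
    using antiderivative_on_einterval[OF F_cont[unfolded J_def] J0[unfolded J_def]]
    unfolding J_def by blast
  obtain X where X0: "X 0 = 0"
    and X: "\<And>\<phi>. \<phi> \<in> J \<Longrightarrow> (X has_real_derivative cos \<phi> * (A \<phi> / (k * height \<phi>))) (at \<phi>)"
    using antiderivative_on_einterval[OF G_cont[unfolded J_def] J0[unfolded J_def]]
    unfolding J_def by blast
  have \<tau>_cont: "continuous_on J \<tau>" using \<tau> by (meson DERIV_isCont continuous_at_imp_continuous_on)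
  have inj: "inj_on \<tau> J"
  proof (rule inj_onI, rule ccontr)
    have *: False if "u \<in> J" "v \<in> J" "u < v" "\<tau> u = \<tau> v" for u v
    proof -
      have uv: "{u..v} \<subseteq> J"
        using mem_is_interval_1_I[OF intJ that(1,2)] by (simp add: subset_iff)
      obtain w where w: "u < w" "w < v"
        and eq: "\<tau> v - \<tau> u = (v - u) * (A w / (k * height w))"
        using MVT2[OF \<open>u < v\<close>, of \<tau> "\<lambda>w. A w / (k * height w)"] \<tau> uv
        by (meson atLeastAtMost_iff subsetD)
      then have "A w / (k * height w) = 0" using that by simp
      moreover have "w \<in> J" using uv w by auto
      ultimately have "A w = 0 \<or> height w = 0" using k_pos by simp
      then show False using J[OF \<open>w \<in> J\<close>] heightJ[OF \<open>w \<in> J\<close>] by simp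
    qed
    fix u v assume "u \<in> J" "v \<in> J" "\<tau> u = \<tau> v" "u \<noteq> v"
    then show False using *[of u v] *[of v u] by linarith
  qed
  define \<psi> where "\<psi> = inv_into J \<tau>"
  have \<psi>\<tau>: "\<And>\<phi>. \<phi> \<in> J \<Longrightarrow> \<psi> (\<tau> \<phi>) = \<phi>" by (simp add: \<psi>_def inj)
  have \<psi>_deriv: "(\<psi> has_real_derivative k * height \<phi> / A \<phi>) (at (\<tau> \<phi>))" if "\<phi> \<in> J" for \<phi>
    using has_real_derivative_left_inverse[OF openJ that \<tau>_cont \<psi>\<tau> \<tau>[OF that]]
      J[OF that] heightJ[OF that] k_pos by simp
  \<comment> \<open>The candidate for the extension, defined on all of \<open>\<tau> ` J\<close>.\<close>
  have prof: "weingarten_profile a b z0 (\<tau> ` J) (X \<circ> \<psi>) (height \<circ> \<psi>) \<psi>"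
    unfolding weingarten_profile_def
  proof (intro conjI ballI)
    show "open (\<tau> ` J)" using invariance_of_domain_gen[OF openJ \<tau>_cont inj] by simp
    show "is_interval (\<tau> ` J)"
      using connected_continuous_image[OF \<tau>_cont connJ] by (simp add: is_interval_connected_1)
    show "0 \<in> \<tau> ` J" using J0 \<tau>0 by force
    have \<psi>0: "\<psi> 0 = 0" using \<psi>\<tau>[OF J0] \<tau>0 by simp
    then show "(X \<circ> \<psi>) 0 = 0" "\<psi> 0 = 0" by (auto simp: X0)
    show "(height \<circ> \<psi>) 0 = z0"
      using z_eq_height[OF zero_in_D] by (simp add: theta_0 z_0 \<psi>0)
    fix s assume "s \<in> \<tau> ` J"
    then obtain \<phi> where \<phi>: "\<phi> \<in> J" "s = \<tau> \<phi>" by blast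
    have nz: "A \<phi> \<noteq> 0" "0 < height \<phi>" "0 < N \<phi>" using J heightJ \<phi> by auto
    show "0 < (height \<circ> \<psi>) s" using nz \<phi> \<psi>\<tau> by simp
    have d: "(\<psi> has_real_derivative k * height \<phi> / A \<phi>) (at s)" using \<psi>_deriv \<phi> by simp
    then show "\<psi> differentiable at s" using real_differentiable_def by blast
    have "\<psi> s = \<phi>" using \<phi> \<psi>\<tau> by simp
    show "(X \<circ> \<psi> has_real_derivative cos (\<psi> s)) (at s)"
      using DERIV_chain[OF X d] \<phi>(1) nz k_pos \<open>\<psi> s = \<phi>\<close> by simp
    show "(height \<circ> \<psi> has_real_derivative sin (\<psi> s)) (at s)"
      using DERIV_chain[OF height_deriv d] nz k_pos \<open>\<psi> s = \<phi>\<close> by simp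
    have dd: "deriv \<psi> s = k * height \<phi> / A \<phi>" using d by (rule DERIV_imp_deriv)
    define q where "q = (height \<circ> \<psi>) s * deriv \<psi> s"
    have q: "A \<phi> * q = N \<phi>"
      using nz height_square[of \<phi>] by (simp add: q_def dd \<open>\<psi> s = \<phi>\<close> power2_eq_square algebra_simps)
    have s2: "(sin \<phi>)\<^sup>2 = 1 - cos \<phi> * cos \<phi>"
      using sin_squared_eq[of \<phi>] by (simp add: power2_eq_square)
    show "a * mean_curvature (height \<circ> \<psi>) \<psi> s + b * gauss_curvature (height \<circ> \<psi>) \<psi> s = 1"
      using q unfolding mean_curvature_def gauss_curvature_def principal_curvature1_def
          principal_curvature2_def q_def[symmetric] \<open>\<psi> s = \<phi>\<close> A_def N_def s2
      by (simp add: field_simps)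
  qed
  have \<tau>\<theta>: "\<tau> (\<theta> s) = s" if s: "s \<in> D" for s
  proof -
    have "\<tau> (\<theta> s) - s = \<tau> (\<theta> 0) - 0"
    proof (rule zero_derivative_eq_on_interval[OF interval_D _ s zero_in_D])
      fix u assume u: "u \<in> D"
      have "((\<lambda>u. \<tau> (\<theta> u)) has_real_derivative
          A (\<theta> u) / (k * height (\<theta> u)) * (k * z u / A (\<theta> u))) (at u)"
        by (rule DERIV_chain2[OF \<tau> theta_deriv[OF u]]) (use sub u in auto)
      then have "((\<lambda>u. \<tau> (\<theta> u)) has_real_derivative 1) (at u)"
        using z_eq_height[OF u] z_pos[OF u] k_pos A_nonzero[OF u] by simp
      then show "((\<lambda>u. \<tau> (\<theta> u) - u) has_real_derivative 0) (at u)"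
        by (auto intro!: derivative_eq_intros)
    qed
    then show ?thesis by (simp add: theta_0 \<tau>0)
  qed
  have X\<theta>: "x s = X (\<theta> s)" if s: "s \<in> D" for s
  proof -
    have "X (\<theta> s) - x s = X (\<theta> 0) - x 0"
    proof (rule zero_derivative_eq_on_interval[OF interval_D _ s zero_in_D])
      fix u assume u: "u \<in> D"
      have "((\<lambda>u. X (\<theta> u)) has_real_derivative
          cos (\<theta> u) * (A (\<theta> u) / (k * height (\<theta> u))) * (k * z u / A (\<theta> u))) (at u)"
        by (rule DERIV_chain2[OF X theta_deriv[OF u]]) (use sub u in auto)
      then have "((\<lambda>u. X (\<theta> u)) has_real_derivative cos (\<theta> u)) (at u)"
        using z_eq_height[OF u] z_pos[OF u] k_pos A_nonzero[OF u] by simp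
      then show "((\<lambda>u. X (\<theta> u) - x u) has_real_derivative 0) (at u)"
        using x_deriv[OF u] by (auto intro!: derivative_eq_intros)
    qed
    then show ?thesis by (simp add: theta_0 X0 x_0)
  qed
  have \<psi>_eq: "\<psi> s = \<theta> s" if "s \<in> D" for s
    using \<psi>\<tau>[of "\<theta> s"] \<tau>\<theta>[OF that] sub that by auto
  have "D \<subseteq> \<tau> ` J" using \<tau>\<theta> sub by (metis image_subset_iff subsetI image_eqI)
  moreover have "\<forall>s\<in>D. (X \<circ> \<psi>) s = x s \<and> (height \<circ> \<psi>) s = z s \<and> \<psi> s = \<theta> s"
    by (simp add: \<psi>_eq X\<theta> z_eq_height)
  ultimately have D: "\<tau> ` J = D"
    using maximal prof unfolding maximal_weingarten_profile_def by blast
  show ?thesis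
  proof (rule that[OF \<tau>0 X0 \<tau> X \<tau>\<theta> X\<theta>])
    show \<tau>D: "\<tau> \<phi> \<in> D" if "\<phi> \<in> J" for \<phi> using D that by blast
    show "\<theta> (\<tau> \<phi>) = \<phi>" if "\<phi> \<in> J" for \<phi> using \<psi>_eq[OF \<tau>D[OF that]] \<psi>\<tau>[OF that] by simp
  qed
qed

end

section \<open>Limits at the ends of a parameter interval\<close>

text \<open>
The limits at the ends are taken in the extended reals; this brings them back to real parameters, for
finite and infinite ends alike.
\<close>

lemma eventually_left_end_iff:
  assumes "einterval c d \<noteq> {}"
  shows "eventually (\<lambda>e. P (real_of_ereal e)) (at_left d) \<longleftrightarrow>
    (\<exists>s1\<in>einterval c d. \<forall>s\<in>einterval c d. s1 < s \<longrightarrow> P s)"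
proof
  have cd: "c < d" using assms by (auto simp: einterval_iff)
  assume "eventually (\<lambda>e. P (real_of_ereal e)) (at_left d)"
  then obtain b where b: "b < d" "\<And>y. b < y \<Longrightarrow> y < d \<Longrightarrow> P (real_of_ereal y)"
    unfolding eventually_at_left[OF cd] by auto
  have "max b c < d" using b(1) cd by simp
  then obtain r where "r \<in> einterval (max b c) d" using einterval_nonempty by blast
  then have r: "b < ereal r" "r \<in> einterval c d" by (auto simp: einterval_iff)
  have "P s" if "s \<in> einterval c d" "r < s" for s
    using b(2)[of "ereal s"] r(1) that less_trans[of b "ereal r" "ereal s"] by (simp add: einterval_iff)
  then show "\<exists>s1\<in>einterval c d. \<forall>s\<in>einterval c d. s1 < s \<longrightarrow> P s" using r(2) by blast
next
  assume "\<exists>s1\<in>einterval c d. \<forall>s\<in>einterval c d. s1 < s \<longrightarrow> P s"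
  then obtain s1 where s1: "s1 \<in> einterval c d" "\<And>s. s \<in> einterval c d \<Longrightarrow> s1 < s \<Longrightarrow> P s" by blast
  then have s1d: "c < ereal s1" "ereal s1 < d" by (auto simp: einterval_iff)
  show "eventually (\<lambda>e. P (real_of_ereal e)) (at_left d)"
    unfolding eventually_at_left[OF s1d(2)]
  proof (intro exI[of _ "ereal s1"] conjI allI impI)
    fix y assume y: "ereal s1 < y" "y < d"
    then obtain r where r: "y = ereal r" by (cases y) auto
    then have "r \<in> einterval c d" using y s1d less_trans[of c "ereal s1" y] by (simp add: einterval_iff)
    then show "P (real_of_ereal y)" using s1(2) y r by simp
  qed (rule s1d)
qed

lemma eventually_right_end_iff:
  assumes "einterval c d \<noteq> {}"
  shows "eventually (\<lambda>e. P (real_of_ereal e)) (at_right c) \<longleftrightarrow>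
    (\<exists>s1\<in>einterval c d. \<forall>s\<in>einterval c d. s < s1 \<longrightarrow> P s)"
proof
  have cd: "c < d" using assms by (auto simp: einterval_iff)
  assume "eventually (\<lambda>e. P (real_of_ereal e)) (at_right c)"
  then obtain b where b: "c < b" "\<And>y. c < y \<Longrightarrow> y < b \<Longrightarrow> P (real_of_ereal y)"
    unfolding eventually_at_right[OF cd] by auto
  have "c < min b d" using b(1) cd by simp
  then obtain r where "r \<in> einterval c (min b d)" using einterval_nonempty by blast
  then have r: "ereal r < b" "r \<in> einterval c d" by (auto simp: einterval_iff)
  have "P s" if "s \<in> einterval c d" "s < r" for s
    using b(2)[of "ereal s"] r(1) that less_trans[of "ereal s" "ereal r" b] by (simp add: einterval_iff)
  then show "\<exists>s1\<in>einterval c d. \<forall>s\<in>einterval c d. s < s1 \<longrightarrow> P s" using r(2) by blast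
next
  assume "\<exists>s1\<in>einterval c d. \<forall>s\<in>einterval c d. s < s1 \<longrightarrow> P s"
  then obtain s1 where s1: "s1 \<in> einterval c d" "\<And>s. s \<in> einterval c d \<Longrightarrow> s < s1 \<Longrightarrow> P s" by blast
  then have s1d: "c < ereal s1" "ereal s1 < d" by (auto simp: einterval_iff)
  show "eventually (\<lambda>e. P (real_of_ereal e)) (at_right c)"
    unfolding eventually_at_right[OF s1d(1)]
  proof (intro exI[of _ "ereal s1"] conjI allI impI)
    fix y assume y: "c < y" "y < ereal s1"
    then obtain r where r: "y = ereal r" by (cases y) auto
    then have "r \<in> einterval c d" using y s1d less_trans[of y "ereal s1" d] by (simp add: einterval_iff)
    then show "P (real_of_ereal y)" using s1(2) y r by simp
  qed (rule s1d)
qed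

lemma mono_tends_at_left_end:
  fixes f :: "real \<Rightarrow> 'a::{conditionally_complete_linorder, linorder_topology}"
  assumes E: "einterval c d \<noteq> {}" and bdd: "bdd_above (f ` einterval c d)"
    and mono: "\<And>s t. s \<in> einterval c d \<Longrightarrow> t \<in> einterval c d \<Longrightarrow> s < t \<Longrightarrow> f s \<le> f t"
  shows "tends_at_end f (Sup (f ` einterval c d)) (at_left d)"
  unfolding tends_at_end_def
proof (rule order_tendstoI)
  fix l assume "l < Sup (f ` einterval c d)"
  then obtain s1 where s1: "s1 \<in> einterval c d" "l < f s1"
    using E bdd by (subst (asm) less_cSup_iff) auto
  then show "eventually (\<lambda>e. l < f (real_of_ereal e)) (at_left d)"
    unfolding eventually_left_end_iff[OF E, where P = "\<lambda>s. l < f s"]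
    using s1(1) mono[OF s1(1)] less_le_trans[OF s1(2)] by blast
next
  fix u assume "Sup (f ` einterval c d) < u"
  then have "f s < u" if "s \<in> einterval c d" for s
    using cSup_upper[OF imageI[OF that] bdd] by (rule le_less_trans[rotated])
  then show "eventually (\<lambda>e. f (real_of_ereal e) < u) (at_left d)"
    unfolding eventually_left_end_iff[OF E, where P = "\<lambda>s. f s < u"] using E by blast
qed

lemma mono_tends_at_right_end:
  fixes f :: "real \<Rightarrow> 'a::{conditionally_complete_linorder, linorder_topology}"
  assumes E: "einterval c d \<noteq> {}" and bdd: "bdd_below (f ` einterval c d)"
    and mono: "\<And>s t. s \<in> einterval c d \<Longrightarrow> t \<in> einterval c d \<Longrightarrow> s < t \<Longrightarrow> f s \<le> f t"
  shows "tends_at_end f (Inf (f ` einterval c d)) (at_right c)"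
  unfolding tends_at_end_def
proof (rule order_tendstoI)
  fix u assume "Inf (f ` einterval c d) < u"
  then obtain s1 where s1: "s1 \<in> einterval c d" "f s1 < u"
    using E bdd by (subst (asm) cInf_less_iff) auto
  then show "eventually (\<lambda>e. f (real_of_ereal e) < u) (at_right c)"
    unfolding eventually_right_end_iff[OF E, where P = "\<lambda>s. f s < u"]
    using s1(1) mono[OF _ s1(1)] le_less_trans[OF _ s1(2)] by blast
next
  fix l assume "l < Inf (f ` einterval c d)"
  then have "l < f s" if "s \<in> einterval c d" for s
    using cInf_lower[OF imageI[OF that] bdd] by (rule less_le_trans)
  then show "eventually (\<lambda>e. l < f (real_of_ereal e)) (at_right c)"
    unfolding eventually_right_end_iff[OF E, where P = "\<lambda>s. l < f s"] using E by blast
qed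

lemma antimono_tends_at_left_end:
  fixes f :: "real \<Rightarrow> 'a::{conditionally_complete_linorder, linorder_topology}"
  assumes E: "einterval c d \<noteq> {}" and bdd: "bdd_below (f ` einterval c d)"
    and mono: "\<And>s t. s \<in> einterval c d \<Longrightarrow> t \<in> einterval c d \<Longrightarrow> s < t \<Longrightarrow> f t \<le> f s"
  shows "tends_at_end f (Inf (f ` einterval c d)) (at_left d)"
  unfolding tends_at_end_def
proof (rule order_tendstoI)
  fix u assume "Inf (f ` einterval c d) < u"
  then obtain s1 where s1: "s1 \<in> einterval c d" "f s1 < u"
    using E bdd by (subst (asm) cInf_less_iff) auto
  then show "eventually (\<lambda>e. f (real_of_ereal e) < u) (at_left d)"
    unfolding eventually_left_end_iff[OF E, where P = "\<lambda>s. f s < u"]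
    using s1(1) mono[OF s1(1)] le_less_trans[OF _ s1(2)] by blast
next
  fix l assume "l < Inf (f ` einterval c d)"
  then have "l < f s" if "s \<in> einterval c d" for s
    using cInf_lower[OF imageI[OF that] bdd] by (rule less_le_trans)
  then show "eventually (\<lambda>e. l < f (real_of_ereal e)) (at_left d)"
    unfolding eventually_left_end_iff[OF E, where P = "\<lambda>s. l < f s"] using E by blast
qed

lemma antimono_tends_at_right_end:
  fixes f :: "real \<Rightarrow> 'a::{conditionally_complete_linorder, linorder_topology}"
  assumes E: "einterval c d \<noteq> {}" and bdd: "bdd_above (f ` einterval c d)"
    and mono: "\<And>s t. s \<in> einterval c d \<Longrightarrow> t \<in> einterval c d \<Longrightarrow> s < t \<Longrightarrow> f t \<le> f s"
  shows "tends_at_end f (Sup (f ` einterval c d)) (at_right c)"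
  unfolding tends_at_end_def
proof (rule order_tendstoI)
  fix l assume "l < Sup (f ` einterval c d)"
  then obtain s1 where s1: "s1 \<in> einterval c d" "l < f s1"
    using E bdd by (subst (asm) less_cSup_iff) auto
  then show "eventually (\<lambda>e. l < f (real_of_ereal e)) (at_right c)"
    unfolding eventually_right_end_iff[OF E, where P = "\<lambda>s. l < f s"]
    using s1(1) mono[OF _ s1(1)] less_le_trans[OF s1(2)] by blast
next
  fix u assume "Sup (f ` einterval c d) < u"
  then have "f s < u" if "s \<in> einterval c d" for s
    using cSup_upper[OF imageI[OF that] bdd] by (rule le_less_trans[rotated])
  then show "eventually (\<lambda>e. f (real_of_ereal e) < u) (at_right c)"
    unfolding eventually_right_end_iff[OF E, where P = "\<lambda>s. f s < u"] using E by blast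
qed

lemma tends_at_left_end_unique:
  fixes f :: "real \<Rightarrow> 'a::t2_space"
  assumes "einterval c d \<noteq> {}" and "tends_at_end f l (at_left d)" and "tends_at_end f l' (at_left d)"
  shows "l = l'"
proof -
  have "at_left d \<noteq> bot"
  proof
    assume "at_left d = bot"
    then have "eventually (\<lambda>e. (\<lambda>_::real. False) (real_of_ereal e)) (at_left d)" by simp
    then obtain s1 where s1: "s1 \<in> einterval c d" "\<And>s. s \<in> einterval c d \<Longrightarrow> \<not> s1 < s"
      unfolding eventually_left_end_iff[OF assms(1), where P = "\<lambda>_. False"] by blast
    then have "c < ereal s1" "ereal s1 < d" by (auto simp: einterval_iff)
    then obtain r where "r \<in> einterval (ereal s1) d" using einterval_nonempty by blast
    then have "r \<in> einterval c d" "s1 < r"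
      using \<open>c < ereal s1\<close> less_trans[of c "ereal s1" "ereal r"] by (auto simp: einterval_iff)
    then show False using s1 by blast
  qed
  then show ?thesis using assms(2,3) unfolding tends_at_end_def by (rule tendsto_unique)
qed

lemma tends_at_left_end_cong:
  assumes E: "einterval c d \<noteq> {}" and "\<And>s. s \<in> einterval c d \<Longrightarrow> f s = g s"
    and "tends_at_end g l (at_left d)"
  shows "tends_at_end f l (at_left d)"
proof -
  have "eventually (\<lambda>e. (\<lambda>s. f s = g s) (real_of_ereal e)) (at_left d)"
    unfolding eventually_left_end_iff[OF E, where P = "\<lambda>s. f s = g s"] using E assms(2) by blast
  then show ?thesis using assms(3) unfolding tends_at_end_def by (simp add: tendsto_cong)
qed

lemma tends_at_right_end_cong:
  assumes E: "einterval c d \<noteq> {}" and "\<And>s. s \<in> einterval c d \<Longrightarrow> f s = g s"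
    and "tends_at_end g l (at_right c)"
  shows "tends_at_end f l (at_right c)"
proof -
  have "eventually (\<lambda>e. (\<lambda>s. f s = g s) (real_of_ereal e)) (at_right c)"
    unfolding eventually_right_end_iff[OF E, where P = "\<lambda>s. f s = g s"] using E assms(2) by blast
  then show ?thesis using assms(3) unfolding tends_at_end_def by (simp add: tendsto_cong)
qed

section \<open>Profiles on a symmetric parameter interval\<close>

text \<open>
On an open domain the neighbourhood in \<open>local_maximum_at\<close> is a full one, so Fermat's criterion applies.
\<close>

lemma local_maximum_stationary:
  assumes "local_maximum_at D f u" and "open D" and "(f has_real_derivative f') (at u)"
  shows "f' = 0"
proof -
  have "u \<in> D" using assms(1) by (simp add: local_maximum_at_def)
  then have "eventually (\<lambda>v. f v \<le> f u) (at u)"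
    using assms(1) at_within_open[OF _ assms(2)] by (simp add: local_maximum_at_def)
  then obtain d where "0 < d" "\<And>v. \<bar>u - v\<bar> < d \<Longrightarrow> f v \<le> f u"
    unfolding eventually_at by (metis dist_real_def dist_commute order_refl UNIV_I)
  then show ?thesis using DERIV_local_max[OF assms(3)] by blast
qed

locale symmetric_weingarten_curve =
  weingarten_curve a b z0 "einterval (- sbar) sbar" x z \<theta>
  for a b z0 :: real and sbar :: ereal and x z \<theta> :: "real \<Rightarrow> real"
begin

abbreviation D :: "real set" where "D \<equiv> einterval (- sbar) sbar"

definition height_bound :: real where "height_bound = sqrt ((1 + a + \<bar>b\<bar>) / k)"

lemma z_le_height_bound: 
  assumes s: "s \<in> D"
  shows "z s \<le> height_bound"
proof -
  have "- (a * cos (\<theta> s)) \<le> a" using mult_left_mono[of "-1" "cos (\<theta> s)" a] a_pos by simp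
  moreover have "b * (sin (\<theta> s))\<^sup>2 \<le> \<bar>b\<bar> * 1"
    by (rule mult_mono) (auto simp: abs_square_le_1)
  ultimately have "N (\<theta> s) \<le> 1 + a + \<bar>b\<bar>" by (simp add: N_def)
  then show ?thesis
    unfolding z_eq_height[OF s] height_def height_bound_def
    using k_pos by (simp add: divide_right_mono)
qed

sublocale strip: profile_strip D x z \<theta> height_bound
  using interval_D x_deriv z_deriv z_pos z_le_height_bound by unfold_locales auto

lemma D_nonempty: "D \<noteq> {}" using zero_in_D by blast

text \<open>
If \<open>a + 2 b\<close> were 0, the equation would degenerate to \<open>a = 1\<close> at the initial point.
\<close>

lemma a_plus_2b_nonzero: "a + 2 * b \<noteq> 0"
  using A_nonzero[OF zero_in_D] by (simp add: theta_0 A_def)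

lemma D_subset: "s \<in> D \<Longrightarrow> t \<in> D \<Longrightarrow> {s..t} \<subseteq> D"
  using mem_is_interval_1_I[OF interval_D, of s t] by (simp add: subset_iff)

lemma D_bounded:
  assumes "\<And>s. s \<in> D \<Longrightarrow> s \<le> C"
  obtains B where "D = {-B<..<B}" and "0 < B"
proof (cases sbar)
  case (real B)
  then have "D = {-B<..<B}" by simp
  then show ?thesis using that zero_in_D by simp
next
  case PInf
  then have "C + 1 \<in> D" by simp
  then show ?thesis using assms by fastforce
next
  case MInf
  then show ?thesis using zero_in_D by (simp add: einterval_iff)
qed

lemma z_mvt:
  assumes "s \<in> D" "t \<in> D" "s < t"
  obtains w where "s < w" "w < t" "w \<in> D" "z t - z s = (t - s) * sin (\<theta> w)"
proof -
  have "\<exists>w>s. w < t \<and> z t - z s = (t - s) * sin (\<theta> w)"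
    by (rule MVT2[OF assms(3)]) (use D_subset[OF assms(1,2)] z_deriv in auto)
  then show ?thesis using that D_subset[OF assms(1,2)] by (metis atLeastAtMost_iff less_imp_le subsetD)
qed

end

section \<open>Profiles with decreasing angle: concave graphs\<close>

text \<open>
Here \<open>\<theta>\<close> decreases along the whole curve, because \<open>A(0) = a/2 + b\<close> is negative.
\<close>

locale descending_curve = symmetric_weingarten_curve +
  assumes descending: "a + 2 * b < 0"
begin

lemma b_neg: "b < 0" using descending a_pos by simp

lemma A_neg: "s \<in> D \<Longrightarrow> A (\<theta> s) < 0"
  using A_same_sign[of s] descending by (simp add: A_def zero_less_mult_iff)

text \<open>
Since \<open>b < 0\<close>, negativity of \<open>A = a/2 + b cos \<theta>\<close> forces \<open>cos \<theta> > 0\<close>.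
\<close>

lemma theta_less_pi_half:
  assumes s: "s \<in> D"
  shows "\<bar>\<theta> s\<bar> < pi / 2"
proof (rule theta_confined[OF _ _ _ s])
  have "cos (\<theta> u) \<noteq> 0" if "u \<in> D" for u using A_neg[OF that] a_pos by (auto simp: A_def)
  then show "\<theta> u \<noteq> pi / 2" "\<theta> u \<noteq> - (pi / 2)" if "u \<in> D" for u
    using that by (metis cos_pi_half, metis cos_minus cos_pi_half)
qed simp

lemma cos_theta_pos: "s \<in> D \<Longrightarrow> 0 < cos (\<theta> s)"
  using theta_less_pi_half[of s] by (intro cos_gt_zero_pi) auto

lemma theta_decreasing:
  assumes "s \<in> D" "t \<in> D" "s < t"
  shows "\<theta> t < \<theta> s"
proof (rule DERIV_neg_imp_decreasing[OF assms(3)])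
  fix u assume "s \<le> u" "u \<le> t"
  then have u: "u \<in> D" using D_subset[OF assms(1,2)] by auto
  have "k * z u / A (\<theta> u) < 0"
    using A_neg[OF u] z_pos[OF u] k_pos by (simp add: divide_neg_pos divide_pos_neg)
  then show "\<exists>y. (\<theta> has_real_derivative y) (at u) \<and> y < 0" using theta_deriv[OF u] by blast
qed

lemma theta_limit: "\<exists>\<theta>1. tends_at_end (\<lambda>s. ereal (\<theta> s)) \<theta>1 (at_left sbar)"
  by (rule exI, rule antimono_tends_at_left_end[OF D_nonempty]) (auto dest: theta_decreasing)

lemma theta_neg: "s \<in> D \<Longrightarrow> 0 < s \<Longrightarrow> \<theta> s < 0"
  and theta_pos: "s \<in> D \<Longrightarrow> s < 0 \<Longrightarrow> 0 < \<theta> s"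
  using theta_decreasing[of 0 s] theta_decreasing[of s 0] zero_in_D theta_0 by auto

lemma sin_theta_neg: "s \<in> D \<Longrightarrow> 0 < s \<Longrightarrow> sin (\<theta> s) < 0"
  using theta_neg[of s] theta_less_pi_half[of s] sin_gt_zero[of "- \<theta> s"] pi_gt_zero by (simp add: abs_less_iff)

lemma sin_theta_pos: "s \<in> D \<Longrightarrow> s < 0 \<Longrightarrow> 0 < sin (\<theta> s)"
  using theta_pos[of s] theta_less_pi_half[of s] by (intro sin_gt_zero) auto

lemma z_decreasing: 
  assumes "s \<in> D" "t \<in> D" "0 \<le> s" "s < t"
  shows "z t < z s"
proof -
  obtain w where w: "s < w" "w \<in> D" "z t - z s = (t - s) * sin (\<theta> w)"
    using z_mvt[OF assms(1,2,4)] by blast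
  have "(t - s) * sin (\<theta> w) < 0" using sin_theta_neg[OF w(2)] w(1) assms by (simp add: mult_pos_neg)
  then show ?thesis using w by simp
qed

lemma z_increasing: 
  assumes "s \<in> D" "t \<in> D" "t \<le> 0" "s < t"
  shows "z s < z t"
proof -
  obtain w where w: "w < t" "w \<in> D" "z t - z s = (t - s) * sin (\<theta> w)"
    using z_mvt[OF assms(1,2,4)] by blast
  have "0 < (t - s) * sin (\<theta> w)" using sin_theta_pos[OF w(2)] w(1) assms by simp
  then show ?thesis using w by simp
qed

lemma one_maximum: "one_maximum_in D z D"
  unfolding one_maximum_in_def
proof (intro bexI[OF _ zero_in_D] conjI ballI impI)
  show "maximum_at D z 0"
    unfolding maximum_at_def
  proof (intro conjI ballI zero_in_D)
    fix u assume "u \<in> D"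
    then show "z u \<le> z 0"
      using z_decreasing[of 0 u] z_increasing[of u 0] zero_in_D by (cases u "0::real" rule: linorder_cases) auto
  qed
  fix u assume u: "u \<in> D" and "local_maximum_at D z u"
  then have "sin (\<theta> u) = 0" using local_maximum_stationary[OF _ open_D z_deriv] by blast
  then show "u = 0"
    using sin_theta_neg[OF u] sin_theta_pos[OF u] by (cases u "0::real" rule: linorder_cases) auto
qed

text \<open>
After a parameter \<open>s0 > 0\<close> the height decreases at least at the rate \<open>- sin (\<theta> s0)\<close>, but it has to stay
positive.
\<close>

lemma bounded_domain:
  obtains B where "D = {-B<..<B}" and "0 < B"
proof -
  obtain s0 where s0: "s0 \<in> D" "0 < s0"
  proof -
    have "eventually (\<lambda>s. s \<in> D) (at_right 0)"
      unfolding at_within_def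
      by (rule filter_leD[OF inf_le1 eventually_nhds_in_open[OF open_D zero_in_D]])
    moreover have "eventually (\<lambda>s::real. 0 < s) (at_right 0)" by (simp add: eventually_at_right_less)
    ultimately have "eventually (\<lambda>s. s \<in> D \<and> 0 < s) (at_right 0)" by (rule eventually_conj)
    then show ?thesis using that eventually_happens'[OF trivial_limit_at_right_real] by blast
  qed
  define m where "m = - sin (\<theta> s0)"
  have m: "0 < m" using sin_theta_neg[OF s0] by (simp add: m_def)
  have "s \<le> s0 + z s0 / m" if s: "s \<in> D" for s
  proof (cases "s0 < s")
    case True
    obtain w where w: "s0 < w" "w \<in> D" "z s - z s0 = (s - s0) * sin (\<theta> w)"
      using z_mvt[OF s0(1) s True] by blast
    have "\<theta> w \<le> \<theta> s0" using theta_decreasing[OF s0(1) w(2,1)] by simp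
    then have "sin (\<theta> w) \<le> - m"
      using theta_less_pi_half[OF s0(1)] theta_less_pi_half[OF w(2)] unfolding m_def
      by (simp add: abs_less_iff sin_monotone_2pi_le)
    then have "(s - s0) * sin (\<theta> w) \<le> (s - s0) * (- m)" using True by (intro mult_left_mono) auto
    then have "(s - s0) * m \<le> z s0" using w(3) z_pos[OF s] by simp
    then show ?thesis using m by (simp add: field_simps)
  next
    case False
    then show ?thesis using m z_pos[OF s0(1)] by (simp add: add_increasing2)
  qed
  then show ?thesis using D_bounded that by blast
qed

lemma x_increasing:
  assumes "s \<in> D" "t \<in> D" "s < t"
  shows "x s < x t"
proof (rule DERIV_pos_imp_increasing[OF assms(3)])
  fix u assume "s \<le> u" "u \<le> t"
  then have u: "u \<in> D" using D_subset[OF assms(1,2)] by auto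
  then show "\<exists>y. (x has_real_derivative y) (at u) \<and> 0 < y" using x_deriv cos_theta_pos by blast
qed

lemma abs_x_le:
  assumes s: "s \<in> D"
  shows "\<bar>x s\<bar> \<le> \<bar>s\<bar>"
proof -
  have "norm (x s - x 0) \<le> 1 * norm (s - 0)"
  proof (rule field_differentiable_bound[of D x "\<lambda>s. cos (\<theta> s)"])
    show "convex D" using interval_D by (rule is_interval_convex)
  qed (use s zero_in_D x_deriv in \<open>auto intro: has_field_derivative_at_within\<close>)
  then show ?thesis by (simp add: x_0)
qed

text \<open>
As a function of \<open>x\<close> the height has the slope \<open>tan \<theta>\<close>, which decreases. The graph lies over a bounded
set, because \<open>x\<close> is 1-Lipschitz on a bounded interval.
\<close>

lemma concave_nonentire_graph: "is_concave_nonentire_vertical_graph (generating_curve x z ` D)"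
proof -
  define g where "g = inv_into D x"
  have inj: "inj_on x D"
    by (rule linorder_inj_onI) (use x_increasing in force)+
  have g: "\<And>s. s \<in> D \<Longrightarrow> g (x s) = s" by (simp add: g_def inj)
  have g_deriv: "(g has_real_derivative inverse (cos (\<theta> s))) (at (x s))" if "s \<in> D" for s
    using has_real_derivative_left_inverse[OF open_D that x_cont g x_deriv[OF that]] cos_theta_pos[OF that]
    by simp
  have "convex_on (x ` D) (\<lambda>u. - z (g u))"
  proof (rule convex_on_realI[where f' = "\<lambda>u. - tan (\<theta> (g u))"])
    show "connected (x ` D)"
      using connected_continuous_image[OF x_cont] interval_D by (simp add: is_interval_connected_1)
    fix u assume "u \<in> x ` D"
    then obtain s where s: "s \<in> D" "u = x s" by blast
    have "(z has_real_derivative sin (\<theta> s)) (at (g u))" using z_deriv s g by simp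
    from DERIV_chain2[OF this g_deriv[OF s(1), folded s(2)]]
    have "((\<lambda>u. z (g u)) has_real_derivative tan (\<theta> s)) (at u)"
      by (simp add: tan_def divide_inverse)
    then show "((\<lambda>u. - z (g u)) has_real_derivative - tan (\<theta> (g u))) (at u)"
      using s g by (auto intro: DERIV_minus)
    fix v assume "v \<in> x ` D" "u \<le> v"
    then obtain t where t: "t \<in> D" "v = x t" by blast
    have "s \<le> t" using x_increasing[OF t(1) s(1)] \<open>u \<le> v\<close> s t by force
    then have "\<theta> t \<le> \<theta> s" using theta_decreasing[OF s(1) t(1)] by force
    then have "tan (\<theta> t) \<le> tan (\<theta> s)"
      using theta_less_pi_half[OF s(1)] theta_less_pi_half[OF t(1)]
      by (intro tan_mono_le) (auto simp: abs_less_iff)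
    then show "- tan (\<theta> (g u)) \<le> - tan (\<theta> (g v))" using s t g by simp
  qed
  then have "concave_on (x ` D) (z \<circ> g)" by (simp add: concave_on_def)
  moreover have "generating_curve x z ` D = vertical_graph (x ` D) (z \<circ> g)"
    by (auto simp: generating_curve_def vertical_graph_def g image_image)
  moreover have "x ` D \<noteq> UNIV"
  proof -
    obtain B where B: "D = {-B<..<B}" "0 < B" by (rule bounded_domain)
    have "x s < B" if "s \<in> D" for s using abs_x_le[OF that] that unfolding B(1) by auto
    then show ?thesis by (metis UNIV_I imageE less_irrefl)
  qed
  ultimately show ?thesis unfolding is_concave_nonentire_vertical_graph_def by blast
qed

text \<open>
As \<open>b < 0\<close>, the identity \<open>(2 A)\<^sup>2 = \<Delta> - 4 b N\<close> bounds \<open>N\<close>, hence the height, away from 0.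
\<close>

lemma incomplete_if_negative_discriminant:
  assumes disc: "a\<^sup>2 + 4 * b\<^sup>2 + 4 * b < 0"
  shows "\<not> complete_surface D x z"
proof -
  define n where "n = (a\<^sup>2 + 4 * b\<^sup>2 + 4 * b) / (4 * b)"
  have n: "0 < n" using disc b_neg by (simp add: n_def divide_neg_neg)
  have N_ge: "n \<le> N \<phi>" for \<phi>
  proof -
    have "4 * b * N \<phi> \<le> a\<^sup>2 + 4 * b\<^sup>2 + 4 * b" using square_A[of \<phi>] zero_le_power2[of "2 * A \<phi>"] by linarith
    then show ?thesis unfolding n_def using b_neg by (simp add: divide_simps mult.commute)
  qed
  obtain B where B: "D = {-B<..<B}" "0 < B" by (rule bounded_domain)
  show ?thesis
  proof (rule strip.incomplete_if_end_at_positive_height[OF B])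
    show "0 < sqrt (n / k)" using n k_pos by simp
    show "sqrt (n / k) \<le> z s" if "s \<in> D" for s
      using z_eq_height[OF that] N_ge k_pos by (simp add: height_def divide_right_mono)
  qed
qed

end

section \<open>Concave graphs that reach the ideal plane\<close>

text \<open>
For a positive discriminant, \<open>N\<close> vanishes at an angle where \<open>A\<close> is still negative, so this zero is met
before the singularity \<open>A = 0\<close> of the equation.
\<close>

locale descending_to_plane = descending_curve +
  assumes discriminant: "0 < a\<^sup>2 + 4 * b\<^sup>2 + 4 * b"
begin

text \<open>
The cosine of \<open>\<beta>\<close> is the larger root of \<open>1 + b - a c - b c\<^sup>2\<close>, which is \<open>N\<close> as a polynomial in the cosine.
\<close>

definition \<beta> :: real where
  "\<beta> = arccos ((a + sqrt (a\<^sup>2 + 4 * b\<^sup>2 + 4 * b)) / (- 2 * b))"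

lemma sqrt_discriminant_less: "sqrt (a\<^sup>2 + 4 * b\<^sup>2 + 4 * b) < - 2 * b - a"
proof (rule real_less_lsqrt)
  have "b < a * b" using b_neg a_less by simp
  then show "a\<^sup>2 + 4 * b\<^sup>2 + 4 * b < (- 2 * b - a)\<^sup>2" by (simp add: power2_eq_square algebra_simps)
qed (use descending in simp)

lemma cos_beta: "cos \<beta> = (a + sqrt (a\<^sup>2 + 4 * b\<^sup>2 + 4 * b)) / (- 2 * b)"
  and beta_pos: "0 < \<beta>" and beta_less: "\<beta> < pi / 2"
proof -
  define c where "c = (a + sqrt (a\<^sup>2 + 4 * b\<^sup>2 + 4 * b)) / (- 2 * b)"
  have "0 < a + sqrt (a\<^sup>2 + 4 * b\<^sup>2 + 4 * b)" using a_pos discriminant by (simp add: add_pos_nonneg)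
  then have "0 < c" unfolding c_def using b_neg by (intro divide_pos_pos) auto
  moreover have "c < 1"
    unfolding c_def using sqrt_discriminant_less b_neg
      pos_divide_less_eq[of "- 2 * b" "a + sqrt (a\<^sup>2 + 4 * b\<^sup>2 + 4 * b)" 1] by linarith
  ultimately show "cos \<beta> = (a + sqrt (a\<^sup>2 + 4 * b\<^sup>2 + 4 * b)) / (- 2 * b)" "0 < \<beta>" "\<beta> < pi / 2"
    using arccos_less_arccos[of c 1] arccos_less_arccos[of 0 c]
    unfolding \<beta>_def c_def[symmetric] by (simp_all add: cos_arccos)
qed

lemma A_beta: "2 * A \<beta> = - sqrt (a\<^sup>2 + 4 * b\<^sup>2 + 4 * b)"
  using b_neg by (simp add: A_def cos_beta field_simps)

lemma N_beta: "N \<beta> = 0" and N_minus_beta: "N (- \<beta>) = 0"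
proof -
  have "(2 * A \<beta>)\<^sup>2 = a\<^sup>2 + 4 * b\<^sup>2 + 4 * b" unfolding A_beta using discriminant by simp
  then have "4 * b * N \<beta> = 0" using square_A[of \<beta>] by linarith
  then show "N \<beta> = 0" using b_neg by simp
  then show "N (- \<beta>) = 0" by (simp add: N_def)
qed

text \<open>
Towards the initial angle the cosine grows, so \<open>A\<close> falls below \<open>A \<beta> < 0\<close> and \<open>(2 A)\<^sup>2\<close> exceeds the
discriminant; by \<open>square_A\<close> this is positivity of \<open>N\<close>.
\<close>

lemma inside_beta:
  assumes "\<bar>\<phi>\<bar> < \<beta>"
  shows "A \<phi> < 0" and "0 < N \<phi>"
proof -
  have "cos \<beta> < cos \<phi>"
    using cos_monotone_0_pi[of "\<bar>\<phi>\<bar>" \<beta>] assms beta_less pi_gt_zero by simp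
  then have lt: "A \<phi> < A \<beta>" using b_neg by (simp add: A_def)
  have neg: "A \<beta> < 0" using A_beta real_sqrt_gt_zero[OF discriminant] by linarith
  show "A \<phi> < 0" using lt neg by simp
  have "(2 * A \<beta>)\<^sup>2 < (2 * A \<phi>)\<^sup>2"
    using power_strict_mono[of "- (2 * A \<beta>)" "- (2 * A \<phi>)" 2] lt neg by simp
  then have "0 < - (4 * b) * N \<phi>" using square_A[of \<phi>] square_A[of \<beta>] N_beta by simp
  then show "0 < N \<phi>" using b_neg by (simp add: zero_less_mult_iff mult_less_0_iff)
qed

lemma theta_less_beta: 
  assumes "s \<in> D"
  shows "\<bar>\<theta> s\<bar> < \<beta>"
proof (rule theta_confined[OF beta_pos _ _ assms])
  show "\<theta> u \<noteq> \<beta>" "\<theta> u \<noteq> - \<beta>" if "u \<in> D" for u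
    using N_pos[OF that] N_beta N_minus_beta by auto
qed

lemma theta_range: "\<theta> ` D = {- \<beta><..<\<beta>}"
proof -
  have J: "einterval (ereal (- \<beta>)) (ereal \<beta>) = {- \<beta><..<\<beta>}" by simp
  have "\<theta> s \<in> {- \<beta><..<\<beta>}" if "s \<in> D" for s using theta_less_beta[OF that] by auto
  then have sub: "\<theta> ` D \<subseteq> {- \<beta><..<\<beta>}" by blast
  obtain \<tau> where "\<And>\<phi>. \<phi> \<in> {- \<beta><..<\<beta>} \<Longrightarrow> \<tau> \<phi> \<in> D" "\<And>\<phi>. \<phi> \<in> {- \<beta><..<\<beta>} \<Longrightarrow> \<theta> (\<tau> \<phi>) = \<phi>"
  proof (rule time_map[of "ereal (- \<beta>)" "ereal \<beta>", unfolded J])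
    show "0 \<in> {- \<beta><..<\<beta>}" using beta_pos by simp
    show "A \<phi> \<noteq> 0 \<and> 0 < N \<phi>" if "\<phi> \<in> {- \<beta><..<\<beta>}" for \<phi>
      using inside_beta[of \<phi>] that by (auto simp: abs_less_iff)
  qed (use sub in auto)
  then have "{- \<beta><..<\<beta>} \<subseteq> \<theta> ` D" by (metis image_eqI subsetI)
  then show ?thesis using sub by blast
qed

lemma theta_at_left_end: "tends_at_end \<theta> (- \<beta>) (at_left sbar)"
proof -
  have "tends_at_end \<theta> (Inf (\<theta> ` D)) (at_left sbar)"
    by (rule antimono_tends_at_left_end[OF D_nonempty]) (use theta_decreasing theta_range in force)+
  then show ?thesis using beta_pos by (simp add: theta_range)
qed

lemma theta_at_right_end: "tends_at_end \<theta> \<beta> (at_right (- sbar))"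
proof -
  have "tends_at_end \<theta> (Sup (\<theta> ` D)) (at_right (- sbar))"
    by (rule antimono_tends_at_right_end[OF D_nonempty]) (use theta_decreasing theta_range in force)+
  then show ?thesis using beta_pos by (simp add: theta_range)
qed

lemma height_isCont: "isCont height \<phi>"
  unfolding height_def[abs_def] using DERIV_isCont[OF N_deriv] k_pos by (intro continuous_intros) auto

lemma z_at_left_end: "tends_at_end z 0 (at_left sbar)"
proof (rule tends_at_left_end_cong[OF D_nonempty z_eq_height])
  show "tends_at_end (\<lambda>s. height (\<theta> s)) 0 (at_left sbar)"
    using isCont_tendsto_compose[OF height_isCont theta_at_left_end[unfolded tends_at_end_def]]
    by (simp add: tends_at_end_def height_def N_minus_beta)
qed

lemma z_at_right_end: "tends_at_end z 0 (at_right (- sbar))"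
proof (rule tends_at_right_end_cong[OF D_nonempty z_eq_height])
  show "tends_at_end (\<lambda>s. height (\<theta> s)) 0 (at_right (- sbar))"
    using isCont_tendsto_compose[OF height_isCont theta_at_right_end[unfolded tends_at_end_def]]
    by (simp add: tends_at_end_def height_def N_beta)
qed

text \<open>
The height tends to 0 at both ends.
\<close>

lemma z_superlevel_compact:
  assumes e: "0 < e"
  obtains c d where "c \<in> D" "d \<in> D" "\<And>s. s \<in> D \<Longrightarrow> e \<le> z s \<Longrightarrow> s \<in> {c..d}"
proof -
  have "eventually (\<lambda>r. z (real_of_ereal r) < e) (at_left sbar)"
    using z_at_left_end e unfolding tends_at_end_def by (rule order_tendstoD(2))
  then obtain d where d: "d \<in> D" "\<And>s. s \<in> D \<Longrightarrow> d < s \<Longrightarrow> z s < e"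
    unfolding eventually_left_end_iff[OF D_nonempty, where P = "\<lambda>s. z s < e"] by blast
  have "eventually (\<lambda>r. z (real_of_ereal r) < e) (at_right (- sbar))"
    using z_at_right_end e unfolding tends_at_end_def by (rule order_tendstoD(2))
  then obtain c where c: "c \<in> D" "\<And>s. s \<in> D \<Longrightarrow> s < c \<Longrightarrow> z s < e"
    unfolding eventually_right_end_iff[OF D_nonempty, where P = "\<lambda>s. z s < e"] by blast
  show ?thesis
  proof (rule that[OF c(1) d(1)])
    show "s \<in> {c..d}" if "s \<in> D" "e \<le> z s" for s
      using c(2)[OF that(1)] d(2)[OF that(1)] that(2) by (auto simp: not_less[symmetric])
  qed
qed

text \<open>
The derivative of \<open>ln z\<close> is \<open>sin \<theta> / z\<close>, so \<open>ln z\<close> is a potential of slope at most 1 in the induced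
metric, and it tends to minus infinity at both ends.
\<close>

lemma complete: "complete_surface D x z"
proof (rule strip.complete_if_proper_potential[where h = "\<lambda>s. ln (z s)"])
  fix s assume s: "s \<in> D"
  show "((\<lambda>s. ln (z s)) has_real_derivative 1 / z s * sin (\<theta> s)) (at s)"
    by (rule DERIV_chain2[OF DERIV_ln_divide[OF z_pos[OF s]] z_deriv[OF s]])
  show "\<bar>1 / z s * sin (\<theta> s)\<bar> \<le> 1 / z s"
    using z_pos[OF s] by (simp add: abs_mult divide_right_mono)
next
  fix C
  obtain c d where cd: "c \<in> D" "d \<in> D" "\<And>s. s \<in> D \<Longrightarrow> exp (- C) \<le> z s \<Longrightarrow> s \<in> {c..d}"
    using z_superlevel_compact[of "exp (- C)"] by auto
  have "{s \<in> D. \<bar>ln (z s)\<bar> \<le> C} \<subseteq> {c..d}"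
  proof
    fix s assume "s \<in> {s \<in> D. \<bar>ln (z s)\<bar> \<le> C}"
    then have "s \<in> D" "- C \<le> ln (z s)" by auto
    then show "s \<in> {c..d}" using cd(3) z_pos ln_ge_iff by blast
  qed
  then show "\<exists>c d. {c..d} \<subseteq> D \<and> {s \<in> D. \<bar>ln (z s)\<bar> \<le> C} \<subseteq> {c..d}"
    using D_subset[OF cd(1,2)] by blast
qed

definition x_left :: real where "x_left = Inf (x ` D)"
definition x_right :: real where "x_right = Sup (x ` D)"

lemma x_bounded: "bdd_above (x ` D)" "bdd_below (x ` D)"
proof -
  obtain B where B: "D = {-B<..<B}" "0 < B" by (rule bounded_domain)
  have "\<bar>x s\<bar> \<le> B" if "s \<in> D" for s using abs_x_le[OF that] that unfolding B(1) by auto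
  then show "bdd_above (x ` D)" "bdd_below (x ` D)"
    by (auto simp: abs_le_iff intro!: bdd_aboveI2[of _ _ B] bdd_belowI2[of _ "- B"]) (metis minus_le_iff)
qed

lemma x_at_left_end: "tends_at_end x x_right (at_left sbar)"
  unfolding x_right_def
  by (rule mono_tends_at_left_end[OF D_nonempty x_bounded(1)]) (use x_increasing less_imp_le in blast)

lemma x_at_right_end: "tends_at_end x x_left (at_right (- sbar))"
  unfolding x_left_def
  by (rule mono_tends_at_right_end[OF D_nonempty x_bounded(2)]) (use x_increasing less_imp_le in blast)

lemma x_left_less_x_right: "x_left < x_right"
proof -
  obtain B where B: "D = {-B<..<B}" "0 < B" by (rule bounded_domain)
  then have "B / 2 \<in> D" by simp
  then have "0 < x (B / 2)" "x (B / 2) \<le> x_right"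
    using x_increasing[OF zero_in_D] B(2) x_0 x_bounded(1) by (auto simp: x_right_def intro: cSup_upper)
  moreover have "x_left \<le> 0"
    using x_bounded(2) zero_in_D x_0 unfolding x_left_def by (metis cInf_lower image_eqI)
  ultimately show ?thesis by simp
qed

lemma vector_derivative_generating_curve:
  assumes "s \<in> D"
  shows "vector_derivative (generating_curve x z) (at s) = (cos (\<theta> s), 0, sin (\<theta> s))"
proof (rule vector_derivative_at)
  show "(generating_curve x z has_vector_derivative (cos (\<theta> s), 0, sin (\<theta> s))) (at s)"
    unfolding generating_curve_def[abs_def]
    using x_deriv[OF assms] z_deriv[OF assms]
    by (intro has_vector_derivative_Pair has_vector_derivative_const)
      (simp_all add: has_real_derivative_iff_has_vector_derivative)
qed

lemma meets_plane_at_left_end: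
  "meets_ideal_plane_at_angle (generating_curve x z) (at_left sbar) (- \<beta>)"
  unfolding meets_ideal_plane_at_angle_def
proof (intro conjI bexI)
  show "(x_right, 0, 0) \<in> ideal_plane" by (simp add: ideal_plane_def)
  show "tends_at_end (generating_curve x z) (x_right, 0, 0) (at_left sbar)"
    using x_at_left_end z_at_left_end unfolding tends_at_end_def generating_curve_def
    by (simp add: tendsto_Pair)
  show "tends_at_end (\<lambda>s. vector_derivative (generating_curve x z) (at s)) (cos (- \<beta>), 0, sin (- \<beta>)) (at_left sbar)"
  proof (rule tends_at_left_end_cong[OF D_nonempty vector_derivative_generating_curve])
    show "tends_at_end (\<lambda>s. (cos (\<theta> s), 0, sin (\<theta> s))) (cos (- \<beta>), 0, sin (- \<beta>)) (at_left sbar)"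
      using theta_at_left_end unfolding tends_at_end_def
      by (simp add: tendsto_Pair tendsto_cos tendsto_sin del: cos_minus sin_minus)
  qed
qed

lemma meets_plane_at_right_end:
  "meets_ideal_plane_at_angle (generating_curve x z) (at_right (- sbar)) \<beta>"
  unfolding meets_ideal_plane_at_angle_def
proof (intro conjI bexI)
  show "(x_left, 0, 0) \<in> ideal_plane" by (simp add: ideal_plane_def)
  show "tends_at_end (generating_curve x z) (x_left, 0, 0) (at_right (- sbar))"
    using x_at_right_end z_at_right_end unfolding tends_at_end_def generating_curve_def
    by (simp add: tendsto_Pair)
  show "tends_at_end (\<lambda>s. vector_derivative (generating_curve x z) (at s)) (cos \<beta>, 0, sin \<beta>) (at_right (- sbar))"
  proof (rule tends_at_right_end_cong[OF D_nonempty vector_derivative_generating_curve])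
    show "tends_at_end (\<lambda>s. (cos (\<theta> s), 0, sin (\<theta> s))) (cos \<beta>, 0, sin \<beta>) (at_right (- sbar))"
      using theta_at_right_end unfolding tends_at_end_def
      by (simp add: tendsto_Pair tendsto_cos tendsto_sin del: cos_minus sin_minus)
  qed
qed

lemma limit_point_if_end_limit:
  assumes "F = at_left sbar \<or> F = at_right (- sbar)"
    and "tends_at_end x x1 F" and "tends_at_end z 0 F"
  shows "(x1, t, 0) \<in> asymptotic_boundary (parabolic_surface D x z)"
proof -
  have lim: "tends_at_end (\<lambda>s. (x s, t, z s)) (x1, t, 0) F"
    using assms(2,3) unfolding tends_at_end_def by (simp add: tendsto_Pair)
  have "\<exists>p\<in>parabolic_surface D x z. p \<noteq> (x1, t, 0) \<and> dist p (x1, t, 0) < e" if e: "0 < e" for e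
  proof -
    have ev: "eventually (\<lambda>r. dist (x (real_of_ereal r), t, z (real_of_ereal r)) (x1, t, 0) < e) F"
      using tendstoD[OF lim[unfolded tends_at_end_def] e] .
    have "\<exists>s\<in>D. dist (x s, t, z s) (x1, t, 0) < e"
      using assms(1)
    proof
      assume F: "F = at_left sbar"
      obtain s1 where s1: "s1 \<in> D" "\<And>s. s \<in> D \<Longrightarrow> s1 < s \<Longrightarrow> dist (x s, t, z s) (x1, t, 0) < e"
        using ev unfolding F
          eventually_left_end_iff[OF D_nonempty, where P = "\<lambda>s. dist (x s, t, z s) (x1, t, 0) < e"]
        by blast
      obtain B where B: "D = {-B<..<B}" "0 < B" by (rule bounded_domain)
      have "(s1 + B) / 2 \<in> D" "s1 < (s1 + B) / 2" using s1(1) unfolding B(1) by auto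
      then show ?thesis using s1(2) by blast
    next
      assume F: "F = at_right (- sbar)"
      obtain s1 where s1: "s1 \<in> D" "\<And>s. s \<in> D \<Longrightarrow> s < s1 \<Longrightarrow> dist (x s, t, z s) (x1, t, 0) < e"
        using ev unfolding F
          eventually_right_end_iff[OF D_nonempty, where P = "\<lambda>s. dist (x s, t, z s) (x1, t, 0) < e"]
        by blast
      obtain B where B: "D = {-B<..<B}" "0 < B" by (rule bounded_domain)
      have "(s1 - B) / 2 \<in> D" "(s1 - B) / 2 < s1" using s1(1) unfolding B(1) by auto
      then show ?thesis using s1(2) by blast
    qed
    then obtain s where s: "s \<in> D" "dist (x s, t, z s) (x1, t, 0) < e" by blast
    moreover have "(x s, t, z s) \<in> parabolic_surface D x z"
      using s(1) by (force simp: parabolic_surface_def parabolic_immersion_def)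
    moreover have "(x s, t, z s) \<noteq> (x1, t, 0)" using z_pos[OF s(1)] by simp
    ultimately show ?thesis by blast
  qed
  then show ?thesis
    by (simp add: asymptotic_boundary_def ideal_plane_def islimpt_approachable)
qed

text \<open>
Away from the ends the height has a positive minimum, and near the ends \<open>x\<close> is close to \<open>x_left\<close> or
\<open>x_right\<close>; so points of the surface near the ideal plane lie close to one of the two lines.
\<close>

lemma limit_point_over_end:
  assumes p: "(x1, t, 0) islimpt parabolic_surface D x z"
  shows "x1 = x_left \<or> x1 = x_right"
proof (rule ccontr)
  assume "\<not> (x1 = x_left \<or> x1 = x_right)"
  define e where "e = min \<bar>x1 - x_left\<bar> \<bar>x1 - x_right\<bar> / 2"
  have e: "0 < e" "2 * e \<le> \<bar>x1 - x_left\<bar>" "2 * e \<le> \<bar>x1 - x_right\<bar>"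
    using \<open>\<not> (x1 = x_left \<or> x1 = x_right)\<close> by (auto simp: e_def)
  have "eventually (\<lambda>r. dist (x (real_of_ereal r)) x_right < e) (at_left sbar)"
    using tendstoD[OF x_at_left_end[unfolded tends_at_end_def] e(1)] .
  then obtain d where d: "d \<in> D" "\<And>s. s \<in> D \<Longrightarrow> d < s \<Longrightarrow> dist (x s) x_right < e"
    unfolding eventually_left_end_iff[OF D_nonempty, where P = "\<lambda>s. dist (x s) x_right < e"] by blast
  have "eventually (\<lambda>r. dist (x (real_of_ereal r)) x_left < e) (at_right (- sbar))"
    using tendstoD[OF x_at_right_end[unfolded tends_at_end_def] e(1)] .
  then obtain c where c: "c \<in> D" "\<And>s. s \<in> D \<Longrightarrow> s < c \<Longrightarrow> dist (x s) x_left < e"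
    unfolding eventually_right_end_iff[OF D_nonempty, where P = "\<lambda>s. dist (x s) x_left < e"] by blast
  obtain m where m: "0 < m" "\<And>s. s \<in> closed_segment c d \<Longrightarrow> m \<le> z s"
    using strip.segment_z_bound[of "(c, 0)" "(d, 0)"] c(1) d(1) by auto
  obtain q where q: "q \<in> parabolic_surface D x z" "dist q (x1, t, 0) < min e m"
    using p e(1) m(1) unfolding islimpt_approachable by (metis min_less_iff_conj)
  then obtain s u where s: "s \<in> D" "q = (x s, u, z s)"
    by (auto simp: parabolic_surface_def parabolic_immersion_def)
  have "dist (x s) x1 \<le> dist q (x1, t, 0)" unfolding s(2) by (metis dist_fst_le fst_conv)
  then have xs: "\<bar>x s - x1\<bar> < e" using q(2) by (simp add: dist_real_def)
  have "dist (z s) 0 \<le> dist q (x1, t, 0)"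
    using dist_snd_le[of "(u, z s)" "(t, 0)"] dist_snd_le[of q "(x1, t, 0)"] by (simp add: s(2))
  then have zs: "z s < m" using q(2) z_pos[OF s(1)] by (simp add: dist_real_def)
  have "\<not> s < c" using c(2)[OF s(1)] xs e by (auto simp: dist_real_def abs_less_iff abs_le_iff)
  moreover have "\<not> d < s" using d(2)[OF s(1)] xs e by (auto simp: dist_real_def abs_less_iff abs_le_iff)
  ultimately have "s \<in> closed_segment c d" by (simp add: closed_segment_eq_real_ivl)
  then show False using m(2) zs by fastforce
qed

lemma asymptotic_boundary_two_lines:
  "two_parallel_straight_lines (asymptotic_boundary (parabolic_surface D x z))"
proof -
  have line: "straight_line (c, 0, 0) (0, 1, 0) = {(c, t, 0) |t. True}" for c :: real
    by (auto simp: straight_line_def)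
  have "asymptotic_boundary (parabolic_surface D x z) =
      straight_line (x_left, 0, 0) (0, 1, 0) \<union> straight_line (x_right, 0, 0) (0, 1, 0)"
  proof (intro equalityI subsetI)
    fix p assume p: "p \<in> asymptotic_boundary (parabolic_surface D x z)"
    obtain x1 t z1 where "p = (x1, t, z1)" by (cases p)
    with p have "p = (x1, t, 0)" "(x1, t, 0) islimpt parabolic_surface D x z"
      by (auto simp: asymptotic_boundary_def ideal_plane_def)
    then show "p \<in> straight_line (x_left, 0, 0) (0, 1, 0) \<union> straight_line (x_right, 0, 0) (0, 1, 0)"
      using limit_point_over_end by (auto simp: line)
  next
    fix p assume "p \<in> straight_line (x_left, 0, 0) (0, 1, 0) \<union> straight_line (x_right, 0, 0) (0, 1, 0)"
    then obtain t where "p = (x_left, t, 0) \<or> p = (x_right, t, 0)" by (auto simp: line)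
    then show "p \<in> asymptotic_boundary (parabolic_surface D x z)"
      using limit_point_if_end_limit x_at_left_end x_at_right_end z_at_left_end z_at_right_end by blast
  qed
  moreover have "straight_line (x_left, 0, 0) (0, 1, 0) \<noteq> straight_line (x_right, 0, 0) (0, 1, 0::real)"
  proof
    assume "straight_line (x_left, 0, 0) (0, 1, 0) = straight_line (x_right, 0, 0) (0, 1, 0::real)"
    moreover have "(x_left, 0, 0) \<in> straight_line (x_left, 0, 0) (0, 1, 0)" by (simp add: line)
    ultimately show False using x_left_less_x_right by (simp add: line)
  qed
  moreover have "(0, 1, 0) \<noteq> (0 :: real \<times> real \<times> real)" by (simp add: zero_prod_def)
  ultimately show ?thesis unfolding two_parallel_straight_lines_def by blast
qed

end

section \<open>Profiles with increasing angle\<close>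

text \<open>
Here \<open>\<theta>\<close> increases along the whole curve, because \<open>A(0) = a/2 + b\<close> is positive.
\<close>

locale ascending_curve = symmetric_weingarten_curve +
  assumes ascending: "0 < a + 2 * b"
begin

lemma A_pos: "s \<in> D \<Longrightarrow> 0 < A (\<theta> s)"
  using A_same_sign[of s] ascending by (simp add: A_def zero_less_mult_iff)

lemma theta_increasing:
  assumes "s \<in> D" "t \<in> D" "s < t"
  shows "\<theta> s < \<theta> t"
proof (rule DERIV_pos_imp_increasing[OF assms(3)])
  fix u assume "s \<le> u" "u \<le> t"
  then have u: "u \<in> D" using D_subset[OF assms(1,2)] by auto
  have "0 < k * z u / A (\<theta> u)" using A_pos[OF u] z_pos[OF u] k_pos by simp
  then show "\<exists>y. (\<theta> has_real_derivative y) (at u) \<and> 0 < y" using theta_deriv[OF u] by blast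
qed

lemma theta_limit: "\<exists>\<theta>1. tends_at_end (\<lambda>s. ereal (\<theta> s)) \<theta>1 (at_left sbar)"
  by (rule exI, rule mono_tends_at_left_end[OF D_nonempty]) (auto dest: theta_increasing)

lemma z_ge_z0:
  assumes "s \<in> D" and "1 - a \<le> N (\<theta> s)"
  shows "z0 \<le> z s"
proof -
  have "k * z0\<^sup>2 \<le> k * (z s)\<^sup>2"
    using assms first_integral[OF assms(1)] z0_pos by (simp add: k_def)
  then show ?thesis using k_pos z0_pos z_pos[OF assms(1)] power2_le_imp_le[of z0 "z s"] by simp
qed

end

section \<open>Periodic profiles\<close>

text \<open>
The two sign conditions say \<open>\<bar>b\<bar> < a/2\<close>, so \<open>A\<close> is bounded below by a positive constant at all angles.
\<close>

locale periodic_curve = ascending_curve +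
  assumes periodic: "0 < a - 2 * b" and discriminant_nonzero: "a\<^sup>2 + 4 * b\<^sup>2 + 4 * b \<noteq> 0"
begin

definition A_min :: real where "A_min = a / 2 - \<bar>b\<bar>"

lemma A_min_pos: "0 < A_min" using ascending periodic by (simp add: A_min_def abs_if)

lemma A_ge: "A_min \<le> A \<phi>"
proof -
  have "\<bar>b * cos \<phi>\<bar> \<le> \<bar>b\<bar> * 1" unfolding abs_mult by (rule mult_left_mono) auto
  then show ?thesis by (simp add: A_def A_min_def abs_le_iff)
qed

lemma A_positive: "0 < A \<phi>" using A_ge[of \<phi>] A_min_pos by simp

text \<open>
These factorizations give both the range of the height and the angles at which it is extremal.
\<close>

lemma N_lower: "N \<phi> - (1 - a) = (1 - cos \<phi>) * (a + b * (1 + cos \<phi>))"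
  and N_upper: "1 + a - N \<phi> = (1 + cos \<phi>) * (a - b * (1 - cos \<phi>))"
proof -
  have s2: "(sin \<phi>)\<^sup>2 = 1 - cos \<phi> * cos \<phi>"
    using sin_squared_eq[of \<phi>] by (simp add: power2_eq_square)
  show "N \<phi> - (1 - a) = (1 - cos \<phi>) * (a + b * (1 + cos \<phi>))"
    and "1 + a - N \<phi> = (1 + cos \<phi>) * (a - b * (1 - cos \<phi>))"
    unfolding N_def s2 by (simp_all add: algebra_simps)
qed

lemma N_bounds: "1 - a \<le> N \<phi>" "N \<phi> \<le> 1 + a"
proof -
  have b: "\<bar>b\<bar> * 2 \<le> a" using A_min_pos by (simp add: A_min_def)
  have "\<bar>1 + cos \<phi>\<bar> \<le> 2" "\<bar>1 - cos \<phi>\<bar> \<le> 2"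
    using cos_ge_minus_one[of \<phi>] cos_le_one[of \<phi>] by linarith+
  then have "\<bar>b * (1 + cos \<phi>)\<bar> \<le> \<bar>b\<bar> * 2" "\<bar>b * (1 - cos \<phi>)\<bar> \<le> \<bar>b\<bar> * 2"
    unfolding abs_mult by (metis mult_left_mono abs_ge_zero)+
  then have "0 \<le> a + b * (1 + cos \<phi>)" "0 \<le> a - b * (1 - cos \<phi>)" using b by linarith+
  moreover have "0 \<le> 1 - cos \<phi>" "0 \<le> 1 + cos \<phi>"
    using cos_ge_minus_one[of \<phi>] cos_le_one[of \<phi>] by linarith+
  ultimately have "0 \<le> N \<phi> - (1 - a)" "0 \<le> 1 + a - N \<phi>"
    unfolding N_lower N_upper by simp_all
  then show "1 - a \<le> N \<phi>" "N \<phi> \<le> 1 + a" by simp_all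
qed

lemma N_positive: "0 < N \<phi>" using N_bounds(1)[of \<phi>] a_less by simp

text \<open>
The derivative of the parameter with respect to the angle.
\<close>

abbreviation F :: "real \<Rightarrow> real" where "F \<phi> \<equiv> A \<phi> / (k * height \<phi>)"

lemma F_pos: "0 < F \<phi>" using A_positive height_pos[OF N_positive] k_pos by simp

definition \<tau> :: "real \<Rightarrow> real" where "\<tau> = inv_into D \<theta>"

definition X :: "real \<Rightarrow> real" where "X \<phi> = x (\<tau> \<phi>)"

lemma \<tau>_0: "\<tau> 0 = 0" and X_0: "X 0 = 0"
  and \<tau>_deriv: "(\<tau> has_real_derivative F \<phi>) (at \<phi>)"
  and X_deriv: "(X has_real_derivative cos \<phi> * F \<phi>) (at \<phi>)"
  and \<tau>_theta: "s \<in> D \<Longrightarrow> \<tau> (\<theta> s) = s"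
  and \<tau>_in_D: "\<tau> \<phi> \<in> D" and theta_\<tau>: "\<theta> (\<tau> \<phi>) = \<phi>"
proof -
  have J: "einterval (- \<infinity>) \<infinity> = UNIV" by simp
  obtain \<tau>' X' where *: "\<tau>' 0 = 0" "X' 0 = 0"
     "\<And>\<phi>. \<phi> \<in> UNIV \<Longrightarrow> (\<tau>' has_real_derivative F \<phi>) (at \<phi>)"
     "\<And>\<phi>. \<phi> \<in> UNIV \<Longrightarrow> (X' has_real_derivative cos \<phi> * F \<phi>) (at \<phi>)"
     "\<And>s. s \<in> D \<Longrightarrow> \<tau>' (\<theta> s) = s" "\<And>s. s \<in> D \<Longrightarrow> x s = X' (\<theta> s)"
     "\<And>\<phi>. \<phi> \<in> UNIV \<Longrightarrow> \<tau>' \<phi> \<in> D" "\<And>\<phi>. \<phi> \<in> UNIV \<Longrightarrow> \<theta> (\<tau>' \<phi>) = \<phi>"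
  proof (rule time_map[of "- \<infinity>" \<infinity>, unfolded J])
    show "A \<phi> \<noteq> 0 \<and> 0 < N \<phi>" for \<phi> using A_positive[of \<phi>] N_positive by simp
  qed auto
  have inj: "inj_on \<theta> D" using *(5) unfolding inj_on_def by metis
  have \<tau>': "\<tau> = \<tau>'"
    using inv_into_f_f[OF inj *(7)] *(8) by (simp add: \<tau>_def fun_eq_iff)
  have "X = X'" using *(6)[OF *(7)] *(8) by (simp add: X_def \<tau>' fun_eq_iff)
  with * \<tau>' show "\<tau> 0 = 0" "X 0 = 0" "(\<tau> has_real_derivative F \<phi>) (at \<phi>)"
     "(X has_real_derivative cos \<phi> * F \<phi>) (at \<phi>)" "s \<in> D \<Longrightarrow> \<tau> (\<theta> s) = s" "\<tau> \<phi> \<in> D" "\<theta> (\<tau> \<phi>) = \<phi>"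
    by simp_all
qed

text \<open>
The derivative of \<open>\<tau>\<close> has a positive lower bound, so the parameter is unbounded as the angle grows.
\<close>

lemma D_UNIV: "D = UNIV"
proof -
  have "\<exists>s\<in>D. C < s" for C
  proof -
    define c where "c = A_min / (k * sqrt ((1 + a) / k))"
    have c: "0 < c" using A_min_pos k_pos a_pos by (simp add: c_def)
    have F_ge: "c \<le> F \<phi>" for \<phi>
      unfolding c_def height_def using A_ge[of \<phi>] A_min_pos k_pos N_bounds[of \<phi>] N_positive[of \<phi>]
      by (intro frac_le mult_left_mono real_sqrt_le_mono divide_right_mono mult_pos_pos) auto
    define \<phi> where "\<phi> = (\<bar>C\<bar> + 1) / c"
    have \<phi>: "0 < \<phi>" using c by (simp add: \<phi>_def)
    obtain w where "\<tau> \<phi> - \<tau> 0 = (\<phi> - 0) * F w"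
      using MVT2[OF \<phi>, of \<tau> F] \<tau>_deriv by blast
    moreover have "\<phi> * c \<le> \<phi> * F w" using F_ge \<phi> by (intro mult_left_mono) auto
    moreover have "\<phi> * c = \<bar>C\<bar> + 1" using c by (simp add: \<phi>_def)
    ultimately have "C < \<tau> \<phi>" using \<tau>_0 by simp
    then show ?thesis using \<tau>_in_D by blast
  qed
  note unbounded = this
  have "sbar = \<infinity>"
  proof (cases sbar)
    case (real r)
    then show ?thesis using unbounded[of r] by (auto simp: einterval_iff)
  next
    case MInf
    then show ?thesis using zero_in_D by (simp add: einterval_iff)
  qed
  then show ?thesis by simp
qed

lemma \<tau>_theta': "\<tau> (\<theta> s) = s" using \<tau>_theta D_UNIV by simp

lemma X_theta: "x s = X (\<theta> s)" by (simp add: X_def \<tau>_theta')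

lemma z_height: "z s = height (\<theta> s)" using z_eq_height D_UNIV by simp

lemma \<tau>_increasing: "\<phi> < \<psi> \<Longrightarrow> \<tau> \<phi> < \<tau> \<psi>"
  using DERIV_pos_imp_increasing[of \<phi> \<psi> \<tau>] \<tau>_deriv F_pos by blast

lemma theta_less_iff: "\<theta> s < \<theta> t \<longleftrightarrow> s < t"
  using theta_increasing D_UNIV by (metis UNIV_I less_asym linorder_neqE_linordered_idom)

lemma N_minus: "N (- \<phi>) = N \<phi>" and A_minus: "A (- \<phi>) = A \<phi>"
  and N_2pi: "N (\<phi> + 2 * pi) = N \<phi>" and A_2pi: "A (\<phi> + 2 * pi) = A \<phi>"
  by (simp_all add: N_def A_def)

lemma F_minus: "F (- \<phi>) = F \<phi>" and F_2pi: "F (\<phi> + 2 * pi) = F \<phi>"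
  by (simp_all only: A_minus A_2pi height_def N_minus N_2pi)

lemma X_minus: "X (- \<phi>) = - X \<phi>"
proof -
  have "X (- \<phi>) + X \<phi> = X (- 0) + X 0"
  proof (rule zero_derivative_eq_on_interval[OF is_interval_univ, where f = "\<lambda>u. X (- u) + X u"])
    fix u
    have "((\<lambda>u. X (- u)) has_real_derivative cos (- u) * F (- u) * (- 1)) (at u)"
      by (rule DERIV_chain2[OF X_deriv]) (auto intro!: derivative_eq_intros)
    from DERIV_add[OF this X_deriv[of u]]
    show "((\<lambda>u. X (- u) + X u) has_real_derivative 0) (at u)" unfolding F_minus by simp
  qed auto
  then show ?thesis by (simp add: X_0)
qed

lemma X_2pi: "X (\<phi> + 2 * pi) = X \<phi> + X (2 * pi)"
proof -
  have "X (\<phi> + 2 * pi) - X \<phi> = X (0 + 2 * pi) - X 0"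
  proof (rule zero_derivative_eq_on_interval[OF is_interval_univ, where f = "\<lambda>u. X (u + 2 * pi) - X u"])
    fix u
    have "((\<lambda>u. X (u + 2 * pi)) has_real_derivative cos (u + 2 * pi) * F (u + 2 * pi) * 1) (at u)"
      by (rule DERIV_chain2[OF X_deriv]) (auto intro!: derivative_eq_intros)
    from DERIV_diff[OF this X_deriv[of u]]
    show "((\<lambda>u. X (u + 2 * pi) - X u) has_real_derivative 0) (at u)" unfolding F_2pi by simp
  qed auto
  then show ?thesis by (simp add: X_0)
qed

lemma \<tau>_2pi: "\<tau> (\<phi> + 2 * pi) = \<tau> \<phi> + \<tau> (2 * pi)"
proof -
  have "\<tau> (\<phi> + 2 * pi) - \<tau> \<phi> = \<tau> (0 + 2 * pi) - \<tau> 0"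
  proof (rule zero_derivative_eq_on_interval[OF is_interval_univ, where f = "\<lambda>u. \<tau> (u + 2 * pi) - \<tau> u"])
    fix u
    have "((\<lambda>u. \<tau> (u + 2 * pi)) has_real_derivative F (u + 2 * pi) * 1) (at u)"
      by (rule DERIV_chain2[OF \<tau>_deriv]) (auto intro!: derivative_eq_intros)
    from DERIV_diff[OF this \<tau>_deriv[of u]]
    show "((\<lambda>u. \<tau> (u + 2 * pi) - \<tau> u) has_real_derivative 0) (at u)" unfolding F_2pi by simp
  qed auto
  then show ?thesis by (simp add: \<tau>_0)
qed

definition T :: real where "T = \<tau> (2 * pi)"
definition p :: real where "p = X (2 * pi)"

lemma T_pos: "0 < T" using \<tau>_increasing[of 0 "2 * pi"] \<tau>_0 by (simp add: T_def)

lemma theta_period: "\<theta> (s + T) = \<theta> s + 2 * pi"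
  using theta_\<tau>[of "\<theta> s + 2 * pi"] by (simp add: \<tau>_2pi \<tau>_theta' T_def)

lemma z_period: "z (s + T) = z s"
  by (simp add: z_height theta_period height_def N_2pi)

lemma x_period: "x (s + T) = x s + p"
  by (simp add: X_theta theta_period X_2pi p_def)

text \<open>
Reflection at 0 and translation by a period compose to a reflection at the angle \<open>pi\<close>.
\<close>

lemma half_period: "p = 2 * X pi"
  using X_2pi[of "- pi"] by (simp add: X_minus p_def)

text \<open>
The half displacement \<open>X pi\<close> is compared by pairing the angles \<open>\<phi>\<close> and \<open>pi - \<phi>\<close>: the function
\<open>X \<phi> - X (pi - \<phi>)\<close> has the derivative \<open>cos \<phi> (F \<phi> - F (pi - \<phi>))\<close>. Comparing the squares of
\<open>F \<phi>\<close> and \<open>F (pi - \<phi>)\<close>, all terms cancel except for the product of \<open>cos \<phi>\<close> with the discriminant, so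
the derivative has no zero in the first quadrant.
\<close>

lemma p_nonzero: "p \<noteq> 0"
proof -
  define Y where "Y \<phi> = X \<phi> - X (pi - \<phi>)" for \<phi>
  have Y: "(Y has_real_derivative cos \<phi> * (F \<phi> - F (pi - \<phi>))) (at \<phi>)" for \<phi>
  proof -
    have "((\<lambda>\<phi>. X (pi - \<phi>)) has_real_derivative cos (pi - \<phi>) * F (pi - \<phi>) * (- 1)) (at \<phi>)"
      by (rule DERIV_chain2[OF X_deriv]) (auto intro!: derivative_eq_intros)
    from DERIV_diff[OF X_deriv[of \<phi>] this]
    show ?thesis unfolding Y_def[abs_def] by (simp add: algebra_simps)
  qed
  obtain w where w: "0 < w" "w < pi / 2"
    and eq: "Y (pi / 2) - Y 0 = (pi / 2 - 0) * (cos w * (F w - F (pi - w)))"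
    using MVT2[of 0 "pi / 2" Y "\<lambda>\<phi>. cos \<phi> * (F \<phi> - F (pi - \<phi>))"] Y by auto
  have cw: "0 < cos w" using w by (intro cos_gt_zero) auto
  have "F w \<noteq> F (pi - w)"
  proof
    assume F: "F w = F (pi - w)"
    have sq: "k * (F \<phi>)\<^sup>2 * N \<phi> = (A \<phi>)\<^sup>2" for \<phi>
      using height_square[OF N_positive, of \<phi>] height_pos[OF N_positive, of \<phi>] k_pos
      by (auto simp: power_divide power_mult_distrib field_simps power2_eq_square)
    have "(A w)\<^sup>2 * N (pi - w) = (A (pi - w))\<^sup>2 * N w"
      unfolding sq[symmetric] F by simp
    moreover have "(A w)\<^sup>2 * N (pi - w) - (A (pi - w))\<^sup>2 * N w =
        a / 2 * cos w * (a\<^sup>2 + 4 * b\<^sup>2 + 4 * b)"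
    proof -
      have s2: "(sin w)\<^sup>2 = 1 - cos w * cos w"
        using sin_squared_eq[of w] by (simp add: power2_eq_square)
      show ?thesis
        unfolding A_def N_def by (simp add: s2) (simp add: field_simps power2_eq_square)
    qed
    ultimately have "a / 2 * cos w * (a\<^sup>2 + 4 * b\<^sup>2 + 4 * b) = 0" by simp
    then show False using a_pos cw discriminant_nonzero by simp
  qed
  then have "Y (pi / 2) - Y 0 \<noteq> 0" unfolding eq using cw by simp
  moreover have "Y (pi / 2) = 0" by (simp add: Y_def)
  moreover have "Y 0 = - X pi" by (simp add: Y_def X_0)
  ultimately show ?thesis by (simp add: half_period)
qed

lemma generating_curve_\<tau>: "generating_curve x z (\<tau> \<phi>) = (X \<phi>, 0, height \<phi>)"
  by (simp add: generating_curve_def X_theta z_height theta_\<tau>)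

text \<open>
The curve is symmetric about the lines \<open>x = 0\<close> and \<open>x = p / 2\<close>, so it meets itself as soon as it returns
to one of them at an angle that is not fixed by the reflection. If \<open>p < 0\<close>, it starts to the right of
\<open>x = 0\<close> and ends the period to its left. If \<open>p > 0\<close>, it moves to the left when it crosses \<open>x = p / 2\<close> at
the angle \<open>pi\<close>, and ends the period to the right of this line.
\<close>

lemma self_intersection: "has_self_intersections D (generating_curve x z)"
proof -
  have X_cont: "continuous_on S X" for S
    using X_deriv by (meson DERIV_isCont continuous_at_imp_continuous_on)
  have "\<exists>\<phi> \<psi>. \<phi> \<noteq> \<psi> \<and> X \<phi> = X \<psi> \<and> height \<phi> = height \<psi>"
  proof (cases "p < 0")
    case True
    have "X 0 < X (pi / 2)"
    proof (rule DERIV_pos_imp_increasing_open[OF pi_half_gt_zero _ X_cont])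
      fix u assume "0 < u" "u < pi / 2"
      then have "0 < cos u * F u" using F_pos cos_gt_zero by (simp del: times_divide_eq_right)
      then show "\<exists>y. (X has_real_derivative y) (at u) \<and> 0 < y" using X_deriv by blast
    qed
    then have "0 \<le> X (pi / 2)" "X (2 * pi) \<le> 0" using True by (simp_all add: X_0 p_def)
    then obtain \<phi> where \<phi>: "pi / 2 \<le> \<phi>" "X \<phi> = 0"
      using IVT2'[of X "2 * pi" 0 "pi / 2"] X_cont by auto
    have "- \<phi> \<noteq> \<phi>" using \<phi>(1) pi_gt_zero by linarith
    moreover have "X (- \<phi>) = X \<phi>" "height (- \<phi>) = height \<phi>"
      using \<phi>(2) by (auto simp: X_minus height_def N_minus)
    ultimately show ?thesis by blast
  next
    case False
    then have "0 < p" using p_nonzero by simp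
    have "X (3 * pi / 2) < X pi"
    proof (rule DERIV_neg_imp_decreasing_open[OF _ _ X_cont])
      fix u assume "pi < u" "u < 3 * pi / 2"
      then have "cos (u - pi) > 0" by (intro cos_gt_zero) auto
      then have "cos u < 0" by simp
      then have "cos u * F u < 0" using F_pos[of u] by (rule mult_neg_pos)
      then show "\<exists>y. (X has_real_derivative y) (at u) \<and> y < 0" using X_deriv by blast
    qed simp
    then have "X (3 * pi / 2) \<le> X pi" "X pi \<le> X (2 * pi)"
      using \<open>0 < p\<close> half_period by (simp_all add: p_def)
    then obtain \<phi> where \<phi>: "3 * pi / 2 \<le> \<phi>" "X \<phi> = X pi"
      using IVT'[of X "3 * pi / 2" "X pi" "2 * pi"] X_cont by auto
    have "X (- \<phi> + 2 * pi) = X \<phi>"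
      unfolding X_2pi X_minus using \<phi>(2) half_period by (simp add: p_def)
    moreover have "height (- \<phi> + 2 * pi) = height \<phi>"
      unfolding height_def N_2pi N_minus ..
    moreover have "- \<phi> + 2 * pi \<noteq> \<phi>" using \<phi>(1) pi_gt_zero by linarith
    ultimately show ?thesis by blast
  qed
  then obtain \<phi> \<psi> where *: "\<phi> \<noteq> \<psi>" "X \<phi> = X \<psi>" "height \<phi> = height \<psi>" by blast
  then have "generating_curve x z (\<tau> \<phi>) = generating_curve x z (\<tau> \<psi>)"
    by (simp add: generating_curve_\<tau>)
  moreover have "\<tau> \<phi> \<noteq> \<tau> \<psi>" using * theta_\<tau> by metis
  ultimately show ?thesis
    unfolding has_self_intersections_def inj_on_def using \<tau>_in_D by blast
qed

text \<open>
The height is bounded, so the parameter divided by this bound is a proper potential.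
\<close>

lemma complete: "complete_surface D x z"
proof (rule strip.complete_if_proper_potential[where h = "\<lambda>s. s / height_bound" and h' = "\<lambda>s. 1 / height_bound"])
  have M: "0 < height_bound" using z_pos[OF zero_in_D] z_le_height_bound[OF zero_in_D] by simp
  show "((\<lambda>s. s / height_bound) has_real_derivative 1 / height_bound) (at s)" for s
    by (rule DERIV_cdivide[OF DERIV_ident])
  show "\<bar>1 / height_bound\<bar> \<le> 1 / z s" if "s \<in> D" for s
    using M z_pos[OF that] z_le_height_bound[OF that] by (simp add: frac_le)
  show "\<exists>c d. {c..d} \<subseteq> D \<and> {s \<in> D. \<bar>s / height_bound\<bar> \<le> C} \<subseteq> {c..d}" for C
  proof (intro exI conjI)
    show "{s \<in> D. \<bar>s / height_bound\<bar> \<le> C} \<subseteq> {- (C * height_bound)..C * height_bound}"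
      using M by (auto simp: abs_le_iff divide_simps)
  qed (simp add: D_UNIV)
qed

lemma translation_period: "periodic_up_to_translation D (generating_curve x z) T p"
  by (simp add: periodic_up_to_translation_def D_UNIV generating_curve_def x_period z_period)

lemma x_int_period: "x (s + of_int n * T) = x s + of_int n * p"
  and z_int_period: "z (s + of_int n * T) = z s"
proof -
  have "x (s + of_int n * T) = x s + of_int n * p \<and> z (s + of_int n * T) = z s"
  proof (induction n rule: int_induct[of _ 0])
    case (step1 i)
    have "s + of_int (i + 1) * T = (s + of_int i * T) + T" by (simp add: algebra_simps)
    then show ?case using step1 x_period[of "s + of_int i * T"] z_period[of "s + of_int i * T"]
      by (simp add: algebra_simps)
  next
    case (step2 i)
    have "s + of_int i * T = (s + of_int (i - 1) * T) + T" by (simp add: algebra_simps)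
    then show ?case using step2 x_period[of "s + of_int (i - 1) * T"] z_period[of "s + of_int (i - 1) * T"]
      by (simp add: algebra_simps)
  qed simp
  then show "x (s + of_int n * T) = x s + of_int n * p" "z (s + of_int n * T) = z s" by simp_all
qed

lemma invariant: "invariant_under (x_translation_group p) (parabolic_surface D x z)"
proof -
  have "(\<lambda>q. q + (of_int n * p, 0, 0)) ` parabolic_surface D x z \<subseteq> parabolic_surface D x z" for n :: int
  proof
    fix q assume "q \<in> (\<lambda>q. q + (of_int n * p, 0, 0)) ` parabolic_surface D x z"
    then obtain s t where "q = (x s, t, z s) + (of_int n * p, 0, 0)"
      by (auto simp: parabolic_surface_def parabolic_immersion_def)
    then have "q = parabolic_immersion x z (s + of_int n * T, t)"
      by (simp add: parabolic_immersion_def x_int_period z_int_period)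
    then show "q \<in> parabolic_surface D x z" by (simp add: parabolic_surface_def D_UNIV)
  qed
  note sub = this
  have "(\<lambda>q. q + (of_int n * p, 0, 0)) ` parabolic_surface D x z = parabolic_surface D x z" for n :: int
  proof
    show "parabolic_surface D x z \<subseteq> (\<lambda>q. q + (of_int n * p, 0, 0)) ` parabolic_surface D x z"
    proof
      fix q assume q: "q \<in> parabolic_surface D x z"
      have "q + (of_int (- n) * p, 0, 0) \<in> parabolic_surface D x z" using sub[of "- n"] q by blast
      moreover have "q = (q + (of_int (- n) * p, 0, 0)) + (of_int n * p, 0, 0)"
        by (cases q) simp
      ultimately show "q \<in> (\<lambda>q. q + (of_int n * p, 0, 0)) ` parabolic_surface D x z" by blast
    qed
  qed (rule sub)
  then show ?thesis by (auto simp: invariant_under_def x_translation_group_def)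
qed

text \<open>
Up to half a turn after a stationary point, \<open>sin \<theta>\<close> has the sign of \<open>cos \<theta>\<close> at that point. Hence a
stationary point with cosine 1 is no local maximum, and one with cosine -1 is no local minimum.
\<close>

lemma z_change_after_stationary:
  assumes st: "sin (\<theta> u) = 0" and e: "0 < e"
  obtains v where "u < v" "v < u + e" "0 < (z v - z u) * cos (\<theta> u)"
proof -
  define v where "v = (u + min (u + e) (\<tau> (\<theta> u + pi))) / 2"
  have lt: "u < \<tau> (\<theta> u + pi)" using \<tau>_increasing[of "\<theta> u" "\<theta> u + pi"] by (simp add: \<tau>_theta')
  then have v: "u < v" "v < u + e" "v < \<tau> (\<theta> u + pi)" using e by (auto simp: v_def min_def)
  obtain w where w: "u < w" "w < v" "z v - z u = (v - u) * sin (\<theta> w)"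
    using z_mvt[of u v] v(1) D_UNIV by auto
  have "\<theta> u < \<theta> w" "\<theta> w < \<theta> u + pi"
    using theta_less_iff[of u w] theta_less_iff[of w "\<tau> (\<theta> u + pi)"] w v theta_\<tau> by auto
  then have pos: "0 < sin (\<theta> w - \<theta> u)" by (intro sin_gt_zero) auto
  have "sin (\<theta> w) = sin ((\<theta> w - \<theta> u) + \<theta> u)" by simp
  also have "\<dots> = sin (\<theta> w - \<theta> u) * cos (\<theta> u)" unfolding sin_add st by simp
  finally have "(z v - z u) * cos (\<theta> u) = (v - u) * sin (\<theta> w - \<theta> u) * (cos (\<theta> u))\<^sup>2"
    using w(3) by (simp add: power2_eq_square)
  moreover have "(cos (\<theta> u))\<^sup>2 = 1" using st sin_cos_squared_add[of "\<theta> u"] by simp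
  ultimately have "0 < (z v - z u) * cos (\<theta> u)" using v(1) pos by simp
  then show ?thesis using that v by blast
qed

lemma local_maximum_cos: "local_maximum_at D z u \<Longrightarrow> cos (\<theta> u) = - 1"
    and local_minimum_cos: "local_minimum_at D z u \<Longrightarrow> cos (\<theta> u) = 1"
proof -
  have zd: "(z has_real_derivative sin (\<theta> u)) (at u)" using z_deriv D_UNIV by simp
  {
    assume "local_maximum_at D z u"
    then have st: "sin (\<theta> u) = 0" by (rule local_maximum_stationary[OF _ open_D zd])
    have "eventually (\<lambda>v. z v \<le> z u) (at u)"
      using \<open>local_maximum_at D z u\<close> by (simp add: local_maximum_at_def D_UNIV)
    then obtain e where e: "0 < e" "\<And>v. v \<noteq> u \<Longrightarrow> dist v u < e \<Longrightarrow> z v \<le> z u"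
      unfolding eventually_at by auto
    obtain v where v: "u < v" "v < u + e" "0 < (z v - z u) * cos (\<theta> u)"
      using z_change_after_stationary[OF st e(1)] by blast
    have "z v \<le> z u" using e(2)[of v] v by (simp add: dist_real_def)
    then have "cos (\<theta> u) < 0" using v(3) by (simp add: zero_less_mult_iff)
    then show "cos (\<theta> u) = - 1" using st sin_zero_abs_cos_one[OF st] by simp
  }
  {
    assume min: "local_minimum_at D z u"
    then have "local_maximum_at D (\<lambda>s. - z s) u" by (simp add: local_minimum_at_def local_maximum_at_def)
    then have st: "sin (\<theta> u) = 0"
      using local_maximum_stationary[OF _ open_D DERIV_minus[OF zd]] by simp
    have "eventually (\<lambda>v. z u \<le> z v) (at u)"
      using min by (simp add: local_minimum_at_def D_UNIV)
    then obtain e where e: "0 < e" "\<And>v. v \<noteq> u \<Longrightarrow> dist v u < e \<Longrightarrow> z u \<le> z v"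
      unfolding eventually_at by auto
    obtain v where v: "u < v" "v < u + e" "0 < (z v - z u) * cos (\<theta> u)"
      using z_change_after_stationary[OF st e(1)] by blast
    have "z u \<le> z v" using e(2)[of v] v by (simp add: dist_real_def)
    then have "0 < cos (\<theta> u)" using v(3) by (simp add: zero_less_mult_iff)
    then show "cos (\<theta> u) = 1" using st sin_zero_abs_cos_one[OF st] by simp
  }
qed

lemma angle_in_window:
  obtains s where "s \<in> {c..<c + T}" "cos (\<theta> s) = cos \<phi>0"
proof -
  \<comment> \<open>The smallest number of full turns that brings the angle \<open>\<phi>0\<close> to at least \<open>\<theta> c\<close>.\<close>
  define n :: int where "n = \<lceil>(\<theta> c - \<phi>0) / (2 * pi)\<rceil>"
  define \<phi> where "\<phi> = \<phi>0 + of_int n * (2 * pi)"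
  have "(\<theta> c - \<phi>0) / (2 * pi) \<le> of_int n" "of_int n < (\<theta> c - \<phi>0) / (2 * pi) + 1"
    unfolding n_def by linarith+
  then have \<phi>: "\<theta> c \<le> \<phi>" "\<phi> < \<theta> c + 2 * pi"
    unfolding \<phi>_def by (simp_all add: divide_simps algebra_simps)
  have "c \<le> \<tau> \<phi>" using \<phi>(1) \<tau>_increasing[of "\<theta> c" \<phi>] \<tau>_theta'[of c] by (cases "\<theta> c = \<phi>") auto
  moreover have "\<tau> \<phi> < c + T"
    using \<tau>_increasing[OF \<phi>(2)] by (simp add: \<tau>_2pi \<tau>_theta' T_def)
  moreover have "cos (\<theta> (\<tau> \<phi>)) = cos \<phi>0"
  proof -
    have "cos \<phi> = cos \<phi>0" unfolding \<phi>_def cos_add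
      using cos_int_2pin[of n] sin_int_2pin[of n] by (simp add: mult.commute mult.assoc)
    then show ?thesis by (simp add: theta_\<tau>)
  qed
  ultimately show ?thesis using that by simp
qed

text \<open>
The angle grows by exactly \<open>2 pi\<close> over the half-open window.
\<close>

lemma same_vertical_angle_in_window:
  assumes "s \<in> {c..<c + T}" "u \<in> {c..<c + T}" "cos (\<theta> s) = cos (\<theta> u)" "\<bar>cos (\<theta> u)\<bar> = 1"
  shows "s = u"
proof -
  have "(cos (\<theta> u))\<^sup>2 = 1" using assms(4) by (metis power2_abs power_one)
  then have "cos (\<theta> s - \<theta> u) = 1"
    using assms(3) sin_cos_squared_add[of "\<theta> u"] unfolding cos_diff by (simp add: power2_eq_square)
  then obtain n :: int where n: "\<theta> s - \<theta> u = of_int n * 2 * pi" using cos_one_2pi_int by blast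
  have "\<theta> v \<in> {\<theta> c..<\<theta> c + 2 * pi}" if "v \<in> {c..<c + T}" for v
    using that theta_less_iff[of v c] theta_less_iff[of v "c + T"] by (auto simp: theta_period)
  from this[OF assms(1)] this[OF assms(2)]
  have "\<bar>of_int n * 2 * pi\<bar> < 2 * pi" unfolding n[symmetric] by auto
  then have "\<bar>of_int n\<bar> < (1::real)" by (simp add: abs_mult)
  then have "n = 0" by linarith
  then have "\<theta> s = \<theta> u" using n by simp
  then show ?thesis using \<tau>_theta' by metis
qed

lemma one_maximum_per_period: "one_maximum_in D z {c..<c + T}"
proof -
  obtain s where s: "s \<in> {c..<c + T}" "cos (\<theta> s) = - 1"
    using angle_in_window[of c pi] by auto
  have Ns: "N (\<theta> s) = 1 + a" using N_upper[of "\<theta> s"] s(2) by simp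
  have "z u \<le> z s" for u
    unfolding z_height height_def Ns using N_bounds(2) k_pos by (simp add: divide_right_mono)
  then have "maximum_at D z s" by (simp add: maximum_at_def D_UNIV)
  moreover have "u = s" if "u \<in> {c..<c + T}" "local_maximum_at D z u" for u
    using same_vertical_angle_in_window[OF that(1) s(1)] local_maximum_cos[OF that(2)] s(2) by simp
  ultimately show ?thesis unfolding one_maximum_in_def using s(1) by blast
qed

lemma one_minimum_per_period: "one_minimum_in D z {c..<c + T}"
proof -
  obtain s where s: "s \<in> {c..<c + T}" "cos (\<theta> s) = 1"
    using angle_in_window[of c 0] by auto
  have Ns: "N (\<theta> s) = 1 - a" using N_lower[of "\<theta> s"] s(2) by simp
  have "z s \<le> z u" for u
    unfolding z_height height_def Ns using N_bounds(1) k_pos by (simp add: divide_right_mono)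
  then have "minimum_at D z s" by (simp add: minimum_at_def D_UNIV)
  moreover have "u = s" if "u \<in> {c..<c + T}" "local_minimum_at D z u" for u
    using same_vertical_angle_in_window[OF that(1) s(1)] local_minimum_cos[OF that(2)] s(2) by simp
  ultimately show ?thesis unfolding one_minimum_in_def using s(1) by blast
qed

end

section \<open>Incomplete profiles that are not graphs\<close>

text \<open>
Now \<open>A\<close> vanishes at an angle \<open>\<beta>\<close> beyond \<open>pi/2\<close>, whereas \<open>N\<close> is never less than \<open>1 - a\<close>.
\<close>

locale ascending_incomplete_curve = ascending_curve +
  assumes nonperiodic: "a - 2 * b \<le> 0"
begin

lemma b_pos: "0 < b" using a_pos nonperiodic by simp

definition \<beta> :: real where "\<beta> = arccos (- a / (2 * b))"

lemma cos_beta: "cos \<beta> = - a / (2 * b)" and beta_gt: "pi / 2 < \<beta>" and beta_le: "\<beta> \<le> pi"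
proof -
  have c: "- 1 \<le> - a / (2 * b)" "- a / (2 * b) < 0"
    using b_pos a_pos nonperiodic by (simp_all add: divide_simps)
  then show "cos \<beta> = - a / (2 * b)" "\<beta> \<le> pi" by (simp_all add: \<beta>_def cos_arccos arccos_ubound)
  show "pi / 2 < \<beta>" using arccos_less_arccos[of "- a / (2 * b)" 0] c by (simp add: \<beta>_def)
qed

lemma N_ge: "1 - a \<le> N \<phi>"
proof -
  have "a * cos \<phi> \<le> a" using mult_left_mono[of "cos \<phi>" 1 a] a_pos by simp
  moreover have "0 \<le> b * (sin \<phi>)\<^sup>2" using b_pos by simp
  ultimately show ?thesis by (simp add: N_def)
qed

lemma N_positive: "0 < N \<phi>" using N_ge[of \<phi>] a_less by simp

lemma A_inside: 
  assumes "\<bar>\<phi>\<bar> < \<beta>"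
  shows "0 < A \<phi>"
proof -
  have "cos \<beta> < cos \<phi>" using cos_monotone_0_pi[of "\<bar>\<phi>\<bar>" \<beta>] assms beta_le by simp
  moreover have b2: "0 < 2 * b" using b_pos by simp
  ultimately have "- a < cos \<phi> * (2 * b)" unfolding cos_beta pos_divide_less_eq[OF b2] by simp
  then show ?thesis by (simp add: A_def algebra_simps)
qed

lemma theta_less_beta: 
  assumes "s \<in> D"
  shows "\<bar>\<theta> s\<bar> < \<beta>"
proof (rule theta_confined[OF _ _ _ assms])
  have "A \<beta> = 0" "A (- \<beta>) = 0" using b_pos by (simp_all add: A_def cos_beta)
  then show "\<theta> u \<noteq> \<beta>" "\<theta> u \<noteq> - \<beta>" if "u \<in> D" for u using A_nonzero[OF that] by auto
  show "0 < \<beta>" using beta_gt pi_gt_zero by linarith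
qed

lemma height_at_least: "s \<in> D \<Longrightarrow> z0 \<le> z s"
  using z_ge_z0 N_ge by blast

lemma minimum: "minimum_at D z 0"
  using height_at_least zero_in_D z_0 by (simp add: minimum_at_def)

text \<open>
The angle is bounded by \<open>pi\<close>, and \<open>\<theta>' = k z / A\<close> has a positive lower bound because \<open>z \<ge> z0\<close>.
\<close>

lemma bounded_domain:
  obtains B where "D = {-B<..<B}" and "0 < B"
proof -
  define c where "c = k * z0 / (a / 2 + b)"
  have c: "0 < c" using k_pos z0_pos ascending by (simp add: c_def)
  have "s \<le> pi / c" if s: "s \<in> D" for s
  proof (cases "0 < s")
    case True
    have "\<exists>w>0. w < s \<and> \<theta> s - \<theta> 0 = (s - 0) * (k * z w / A (\<theta> w))"
      by (rule MVT2[OF True]) (use D_subset[OF zero_in_D s] theta_deriv in auto)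
    then obtain w where w: "0 < w" "w < s" "\<theta> s = s * (k * z w / A (\<theta> w))" by (auto simp: theta_0)
    have wD: "w \<in> D" using D_subset[OF zero_in_D s] w by auto
    have "A (\<theta> w) \<le> a / 2 + b"
      using mult_left_mono[of "cos (\<theta> w)" 1 b] b_pos by (simp add: A_def)
    then have "c \<le> k * z w / A (\<theta> w)"
      unfolding c_def using A_pos[OF wD] height_at_least[OF wD] k_pos z0_pos
      by (intro frac_le mult_left_mono) auto
    then have "s * c \<le> \<theta> s" unfolding w(3) using True by (intro mult_left_mono) auto
    also have "\<dots> \<le> pi" using theta_less_beta[OF s] beta_le by simp
    finally show ?thesis using c by (simp add: pos_le_divide_eq)
  next
    case False
    then show ?thesis using c pi_gt_zero by (simp add: order_trans[of s 0])
  qed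
  then show ?thesis using D_bounded that by blast
qed

lemma incomplete: "\<not> complete_surface D x z"
proof -
  obtain B where "D = {-B<..<B}" "0 < B" by (rule bounded_domain)
  then show ?thesis
    using strip.incomplete_if_end_at_positive_height z0_pos height_at_least by blast
qed

text \<open>
By \<open>time_map\<close> the angle passes \<open>pi/2\<close>, where \<open>x\<close> turns back while \<open>z\<close> keeps increasing. An abscissa
slightly below the turning value is therefore attained at two different heights.
\<close>

lemma not_vertical_graph: "\<not> is_vertical_graph (generating_curve x z ` D)"
proof
  assume "is_vertical_graph (generating_curve x z ` D)"
  then obtain S f where graph: "generating_curve x z ` D = vertical_graph S f"
    unfolding is_vertical_graph_def by blast
  have z_unique: "z s = z t" if "s \<in> D" "t \<in> D" "x s = x t" for s t
  proof -
    have "generating_curve x z s \<in> vertical_graph S f" "generating_curve x z t \<in> vertical_graph S f"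
      using that(1,2) graph by blast+
    then show ?thesis using that(3) by (auto simp: vertical_graph_def generating_curve_def)
  qed
  have J: "einterval (ereal (- \<beta>)) (ereal \<beta>) = {- \<beta><..<\<beta>}" by simp
  have b0: "0 < \<beta>" using beta_gt pi_gt_zero by linarith
  have "\<theta> s \<in> {- \<beta><..<\<beta>}" if "s \<in> D" for s using theta_less_beta[OF that] by auto
  then have sub: "\<theta> ` D \<subseteq> {- \<beta><..<\<beta>}" by blast
  obtain \<tau> X where X0: "X 0 = 0"
    and X: "\<And>\<phi>. \<phi> \<in> {- \<beta><..<\<beta>} \<Longrightarrow> (X has_real_derivative cos \<phi> * (A \<phi> / (k * height \<phi>))) (at \<phi>)"
    and xX: "\<And>s. s \<in> D \<Longrightarrow> x s = X (\<theta> s)"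
    and \<tau>: "\<And>\<phi>. \<phi> \<in> {- \<beta><..<\<beta>} \<Longrightarrow> \<tau> \<phi> \<in> D" "\<And>\<phi>. \<phi> \<in> {- \<beta><..<\<beta>} \<Longrightarrow> \<theta> (\<tau> \<phi>) = \<phi>"
  proof (rule time_map[of "ereal (- \<beta>)" "ereal \<beta>", unfolded J])
    show "0 \<in> {- \<beta><..<\<beta>}" using b0 by simp
    show "A \<phi> \<noteq> 0 \<and> 0 < N \<phi>" if "\<phi> \<in> {- \<beta><..<\<beta>}" for \<phi>
      using A_inside[of \<phi>] that N_positive by (auto simp: abs_less_iff)
  qed (use sub in auto)
  have F: "0 < A \<phi> / (k * height \<phi>)" if "\<phi> \<in> {- \<beta><..<\<beta>}" for \<phi>
    using A_inside[of \<phi>] that height_pos[OF N_positive] k_pos by (simp add: abs_less_iff)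
  have X_cont: "continuous_on {0..\<phi>} X" if "\<phi> < \<beta>" for \<phi>
  proof (intro continuous_at_imp_continuous_on ballI)
    fix u assume "u \<in> {0..\<phi>}"
    then show "isCont X u" using X[of u] that b0 by (intro DERIV_isCont) auto
  qed
  have X_incr: "X u < X v" if "0 \<le> u" "u < v" "v \<le> pi / 2" for u v
  proof (rule DERIV_pos_imp_increasing_open[OF that(2)])
    fix w assume w: "u < w" "w < v"
    then have J: "w \<in> {- \<beta><..<\<beta>}" using that beta_gt b0 by auto
    have "0 < cos w" using w that by (intro cos_gt_zero) auto
    then have "0 < cos w * (A w / (k * height w))" using F[OF J] by (rule mult_pos_pos)
    then show "\<exists>y. (X has_real_derivative y) (at w) \<and> 0 < y" using X[OF J] by blast
  next
    have "v < \<beta>" using that(3) beta_gt by simp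
    then show "continuous_on {u..v} X"
      using continuous_on_subset[OF X_cont, of v "{u..v}"] that(1) by simp
  qed
  have X_decr: "X v < X u" if "pi / 2 \<le> u" "u < v" "v < \<beta>" for u v
  proof (rule DERIV_neg_imp_decreasing_open[OF that(2)])
    fix w assume w: "u < w" "w < v"
    have "- \<beta> < w" "w < \<beta>" using w that b0 pi_gt_zero by linarith+
    then have J: "w \<in> {- \<beta><..<\<beta>}" by simp
    have "cos w < 0" using w that beta_le cos_monotone_0_pi[of "pi / 2" w] pi_gt_zero by simp
    then have "cos w * (A w / (k * height w)) < 0" using F[OF J] by (rule mult_neg_pos)
    then show "\<exists>y. (X has_real_derivative y) (at w) \<and> y < 0" using X[OF J] by blast
  next
    have "0 \<le> u" using that(1) pi_gt_zero by linarith
    then show "continuous_on {u..v} X"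
      using continuous_on_subset[OF X_cont[OF that(3)], of "{u..v}"] by simp
  qed
  have "- \<beta> < pi / 2" using b0 pi_gt_zero by linarith
  then have "isCont X (pi / 2)" using DERIV_isCont[OF X[of "pi / 2"]] beta_gt by simp
  moreover have "0 < X (pi / 2)" using X_incr[of 0 "pi / 2"] X0 by simp
  ultimately obtain d where d: "0 < d" "\<And>\<phi>. \<bar>\<phi> - pi / 2\<bar> < d \<Longrightarrow> 0 < X \<phi>"
    using isCont_def order_tendstoD(1)[of X "X (pi / 2)" "at (pi / 2)" 0]
    unfolding eventually_at by (metis dist_real_def \<open>0 < X (pi / 2)\<close> UNIV_I)
  \<comment> \<open>Close enough to \<open>pi/2\<close> that the abscissa is still positive, so it is also attained before \<open>pi/2\<close>.\<close>
  define \<phi>1 where "\<phi>1 = pi / 2 + min d (\<beta> - pi / 2) / 2"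
  have \<phi>1: "pi / 2 < \<phi>1" "\<phi>1 < \<beta>" "\<bar>\<phi>1 - pi / 2\<bar> < d"
    using d(1) beta_gt by (auto simp: \<phi>1_def min_def field_simps)
  have "X 0 \<le> X \<phi>1" "X \<phi>1 \<le> X (pi / 2)"
    using d(2)[OF \<phi>1(3)] X0 X_decr[of "pi / 2" \<phi>1] \<phi>1 by auto
  then obtain \<phi>0 where \<phi>0: "0 \<le> \<phi>0" "\<phi>0 \<le> pi / 2" "X \<phi>0 = X \<phi>1"
    using IVT'[of X 0 "X \<phi>1" "pi / 2"] X_cont[of "pi / 2"] beta_gt by auto
  have "\<phi>0 < \<phi>1" using \<phi>0 \<phi>1 by simp
  then have "height \<phi>0 < height \<phi>1"
  proof (rule DERIV_pos_imp_increasing_open)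
    fix w assume w: "\<phi>0 < w" "w < \<phi>1"
    then have "0 < sin w" using \<phi>0 \<phi>1 beta_le by (intro sin_gt_zero) auto
    moreover have "0 < A w" using w \<phi>0 \<phi>1 by (intro A_inside) auto
    ultimately have "0 < sin w * A w / (k * height w)"
      using k_pos height_pos[OF N_positive] by simp
    then show "\<exists>y. (height has_real_derivative y) (at w) \<and> 0 < y"
      using height_deriv[OF N_positive] by blast
  next
    show "continuous_on {\<phi>0..\<phi>1} height"
      using height_deriv[OF N_positive] by (meson DERIV_isCont continuous_at_imp_continuous_on)
  qed
  moreover have J01: "\<phi>0 \<in> {- \<beta><..<\<beta>}" "\<phi>1 \<in> {- \<beta><..<\<beta>}"
    using \<phi>0 \<phi>1 b0 beta_gt pi_gt_zero by auto
  moreover have "x (\<tau> \<phi>0) = x (\<tau> \<phi>1)"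
    using xX[OF \<tau>(1)[OF J01(1)]] xX[OF \<tau>(1)[OF J01(2)]] \<tau>(2)[OF J01(1)] \<tau>(2)[OF J01(2)] \<phi>0(3) by simp
  then have "z (\<tau> \<phi>0) = z (\<tau> \<phi>1)" using z_unique \<tau>(1) J01 by blast
  then have "height \<phi>0 = height \<phi>1"
    using z_eq_height[OF \<tau>(1)[OF J01(1)]] z_eq_height[OF \<tau>(1)[OF J01(2)]] \<tau>(2)[OF J01(1)] \<tau>(2)[OF J01(2)] by simp
  ultimately show False by simp
qed

end

section \<open>Classification\<close>

text \<open>
The discriminant is \<open>(2 b + 1)\<^sup>2 - (1 - a\<^sup>2)\<close>, so the bound on \<open>b\<close> marks its smaller root.
\<close>

lemma discriminant_pos_below:
  fixes a b :: real
  assumes a: "0 < a" "a < 1" and b: "b < - (1 + sqrt (1 - a\<^sup>2)) / 2"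
  shows "0 < a\<^sup>2 + 4 * b\<^sup>2 + 4 * b"
proof -
  define r where "r = sqrt (1 - a\<^sup>2)"
  have "a\<^sup>2 \<le> 1" using a by (simp add: abs_square_le_1)
  then have r: "0 \<le> r" "r\<^sup>2 = 1 - a\<^sup>2" by (simp_all add: r_def)
  have "r < - (2 * b + 1)" using b by (simp add: r_def)
  then have "r\<^sup>2 < (- (2 * b + 1))\<^sup>2" using r(1) by (intro power_strict_mono) auto
  then show ?thesis using r(2) by (simp add: power2_eq_square algebra_simps)
qed

text \<open>
The lower bound is the smaller root of the discriminant in \<open>b\<close>, and \<open>- a / 2\<close> lies below the larger
one, since \<open>1 - a < sqrt (1 - a\<^sup>2)\<close>.
\<close>

lemma discriminant_neg_between:
  fixes a b :: real
  assumes a: "0 < a" "a < 1" and b: "- (1 + sqrt (1 - a\<^sup>2)) / 2 < b" "b < - a / 2"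
  shows "a\<^sup>2 + 4 * b\<^sup>2 + 4 * b < 0"
proof -
  define r where "r = sqrt (1 - a\<^sup>2)"
  have "a\<^sup>2 \<le> 1" using a by (simp add: abs_square_le_1)
  then have r: "0 \<le> r" "r\<^sup>2 = 1 - a\<^sup>2" by (simp_all add: r_def)
  have "(1 - a) * (1 - a) < (1 - a) * (1 + a)" using a by (intro mult_strict_left_mono) auto
  then have "1 - a < r"
    unfolding r_def by (intro real_less_rsqrt) (simp add: power2_eq_square algebra_simps)
  then have "\<bar>2 * b + 1\<bar> < r" using b by (simp add: r_def abs_less_iff)
  then have "\<bar>2 * b + 1\<bar>\<^sup>2 < r\<^sup>2" by (intro power_strict_mono) auto
  then show ?thesis using r(2) by (simp add: power2_eq_square algebra_simps)
qed

theorem theorem4p3: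
  fixes a b z0 :: real and sbar :: ereal and x z \<theta> :: "real \<Rightarrow> real"
  defines "D \<equiv> einterval (- sbar) sbar"
  defines "\<alpha> \<equiv> generating_curve x z"
  defines "S \<equiv> parabolic_surface D x z"
  assumes "0 < a" and "a < 1" and "b \<noteq> 0" and "a\<^sup>2 + 4 * b\<^sup>2 + 4 * b \<noteq> 0"
    and "z0 > 0"
    and "maximal_weingarten_profile a b z0 D x z \<theta>"
  shows "\<exists>\<theta>1 :: ereal. tends_at_end (\<lambda>s. ereal (\<theta> s)) \<theta>1 (at_left sbar) \<and>
    (a + 2 * b < 0 \<longrightarrow>
       one_maximum_in D z D \<and>
       is_concave_nonentire_vertical_graph (\<alpha> ` D) \<and>
       (b < - (1 + sqrt (1 - a\<^sup>2)) / 2 \<longrightarrow>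
          complete_surface D x z \<and>
          (\<exists>\<phi>::real. \<theta>1 = ereal \<phi> \<and>
             a * cos \<phi> - b * (sin \<phi>)\<^sup>2 - 1 = 0 \<and>
             meets_ideal_plane_at_angle \<alpha> (at_left sbar) \<phi> \<and>
             meets_ideal_plane_at_angle \<alpha> (at_right (- sbar)) (- \<phi>)) \<and>
          two_parallel_straight_lines (asymptotic_boundary S)) \<and>
       (- (1 + sqrt (1 - a\<^sup>2)) / 2 < b \<and> b < - a / 2 \<longrightarrow>
          \<not> complete_surface D x z)) \<and>
    (a + 2 * b > 0 \<longrightarrow>
       (a - 2 * b > 0 \<longrightarrow>
          complete_surface D x z \<and>
          (\<exists>T p. T > 0 \<and> p \<noteq> 0 \<and>
             invariant_under (x_translation_group p) S \<and>
             periodic_up_to_translation D \<alpha> T p \<and>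
             (\<forall>c\<in>D. one_maximum_in D z {c..<c + T} \<and> one_minimum_in D z {c..<c + T})) \<and>
          has_self_intersections D \<alpha>) \<and>
       (a - 2 * b \<le> 0 \<longrightarrow>
          \<not> complete_surface D x z \<and>
          \<not> is_vertical_graph (\<alpha> ` D) \<and>
          (\<exists>s. minimum_at D z s)))"
proof -
  interpret C: symmetric_weingarten_curve a b z0 sbar x z \<theta>
    using assms(4,5,8,9) by unfold_locales (simp_all add: D_def)
  have limit: "\<exists>\<theta>1. tends_at_end (\<lambda>s. ereal (\<theta> s)) \<theta>1 (at_left sbar)"
  proof (cases "a + 2 * b < 0")
    case True
    then interpret descending_curve a b z0 sbar x z \<theta> by unfold_locales
    show ?thesis by (rule theta_limit)
  next
    case False
    then interpret ascending_curve a b z0 sbar x z \<theta>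
      using C.a_plus_2b_nonzero by unfold_locales simp
    show ?thesis by (rule theta_limit)
  qed
  then obtain \<theta>1 where \<theta>1: "tends_at_end (\<lambda>s. ereal (\<theta> s)) \<theta>1 (at_left sbar)" ..
  show ?thesis
    unfolding D_def \<alpha>_def S_def
  proof (intro exI[of _ \<theta>1] conjI impI)
    show "tends_at_end (\<lambda>s. ereal (\<theta> s)) \<theta>1 (at_left sbar)" by (rule \<theta>1)
  next
    assume "a + 2 * b < 0"
    then interpret descending_curve a b z0 sbar x z \<theta> by unfold_locales
    show "one_maximum_in (einterval (- sbar) sbar) z (einterval (- sbar) sbar)"
      by (rule one_maximum)
    show "is_concave_nonentire_vertical_graph (generating_curve x z ` einterval (- sbar) sbar)"
      by (rule concave_nonentire_graph)
    {
      assume "b < - (1 + sqrt (1 - a\<^sup>2)) / 2"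
      then interpret descending_to_plane a b z0 sbar x z \<theta>
        using discriminant_pos_below[OF C.a_pos C.a_less] by unfold_locales
      show "complete_surface (einterval (- sbar) sbar) x z" by (rule complete)
      show "two_parallel_straight_lines
          (asymptotic_boundary (parabolic_surface (einterval (- sbar) sbar) x z))"
        by (rule asymptotic_boundary_two_lines)
      show "\<exists>\<phi>::real. \<theta>1 = ereal \<phi> \<and> a * cos \<phi> - b * (sin \<phi>)\<^sup>2 - 1 = 0 \<and>
          meets_ideal_plane_at_angle (generating_curve x z) (at_left sbar) \<phi> \<and>
          meets_ideal_plane_at_angle (generating_curve x z) (at_right (- sbar)) (- \<phi>)"
      proof (intro exI[of _ "- \<beta>"] conjI)
        have "tends_at_end (\<lambda>s. ereal (\<theta> s)) (ereal (- \<beta>)) (at_left sbar)"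
          using theta_at_left_end unfolding tends_at_end_def by (rule tendsto_ereal)
        then show "\<theta>1 = ereal (- \<beta>)" using tends_at_left_end_unique[OF C.D_nonempty \<theta>1] by blast
        show "a * cos (- \<beta>) - b * (sin (- \<beta>))\<^sup>2 - 1 = 0" using N_minus_beta unfolding C.N_def by linarith
        show "meets_ideal_plane_at_angle (generating_curve x z) (at_left sbar) (- \<beta>)"
          by (rule meets_plane_at_left_end)
        show "meets_ideal_plane_at_angle (generating_curve x z) (at_right (- sbar)) (- (- \<beta>))"
          using meets_plane_at_right_end by simp
      qed
    }
    show "\<not> complete_surface (einterval (- sbar) sbar) x z"
      if "- (1 + sqrt (1 - a\<^sup>2)) / 2 < b \<and> b < - a / 2"
      using incomplete_if_negative_discriminant discriminant_neg_between[OF C.a_pos C.a_less] that by blast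
  next
    assume pos: "0 < a + 2 * b"
    {
      assume "0 < a - 2 * b"
      with pos interpret periodic_curve a b z0 sbar x z \<theta>
        using assms(7) by unfold_locales
      show "complete_surface (einterval (- sbar) sbar) x z" by (rule complete)
      show "has_self_intersections (einterval (- sbar) sbar) (generating_curve x z)"
        by (rule self_intersection)
      show "\<exists>T p. 0 < T \<and> p \<noteq> 0 \<and>
          invariant_under (x_translation_group p) (parabolic_surface (einterval (- sbar) sbar) x z) \<and>
          periodic_up_to_translation (einterval (- sbar) sbar) (generating_curve x z) T p \<and>
          (\<forall>c\<in>einterval (- sbar) sbar. one_maximum_in (einterval (- sbar) sbar) z {c..<c + T} \<and>
             one_minimum_in (einterval (- sbar) sbar) z {c..<c + T})"
        using T_pos p_nonzero invariant translation_period one_maximum_per_period one_minimum_per_period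
        by blast
    }
    {
      assume "a - 2 * b \<le> 0"
      with pos interpret ascending_incomplete_curve a b z0 sbar x z \<theta> by unfold_locales
      show "\<not> complete_surface (einterval (- sbar) sbar) x z" by (rule incomplete)
      show "\<not> is_vertical_graph (generating_curve x z ` einterval (- sbar) sbar)"
        by (rule not_vertical_graph)
      show "\<exists>s. minimum_at (einterval (- sbar) sbar) z s" using minimum by blast
    }
  qed
qed

end
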